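(* Let $d\ge1$, $0<q<2$, $K(z)=-|z|^q$ on $\mathbb R^d$. Assume one of the following: (i) $d+q-2>0$ and $p_c<p\le\infty$, where $p_c:=d/(d+q-2)$; (ii) $d=q=1$ and $p=\infty$; (iii) $d=1$, $0<q<1$, and $1/q<p\le\infty$. Let $\mu\in\mathcal P_{\max\{1,q\}}(\mathbb R^d)\cap L^p(\mathbb R^d)$ be a probability density. For each $N\ge2$ let $X_N=(x_i^N)_{i\in[N]}\in(\mathbb R^d)^N$ have pairwise distinct components, and set $$\rho^N:=\frac1N\sum_{i=1}^N\delta_{x_i^N},\qquad b_i(X_N):=-\frac1N\sum_{j\in[N]\setminus\{i\}}\nabla K(x_i^N-x_j^N)+\nabla K*\mu(x_i^N).$$ Suppose that, for some $\rho\in\mathcal P(\mathbb R^d)$, $$\rho^N\rightharpoonup\rho\ \text{ narrowly},\qquad \frac1N\sum_{i=1}^N|b_i(X_N)|^2\longrightarrow0.$$ When $0<q<1$, suppose in addition that $$\sup_{N\ge2}\frac1{N^2}\sum_{\substack{i,j\in[N]\\ i\ne j}}\frac1{|x_i^N-x_j^N|^{1-q}}<\infty.$$ When $1<q<2$, suppose instead that, for some $r>q-1$, $$\sup_{N\ge2}\int_{\mathbb R^d}|x|^r\,\mathrm d\rho^N(x)<\infty.$$ (No additional hypothesis is imposed when $q=1$.) Then $\rho$ is a Lagrangian critical point of the MMD energy with target $\mu$.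
   Context: $[N]=\{1,\dots,N\}$; $\mathcal P(\mathbb R^d)$ is the set of Borel probability measures and $\mathcal P_s(\mathbb R^d)$ the subset with finite $s$-th moment; densities are identified with measures. The MMD energy with target $\mu$ is $E_\mu(\rho)=\mathrm{MMD}_q^2(\rho,\mu)=\frac12\iint(|x|^q+|y|^q-|x-y|^q)\,\mathrm d(\rho-\mu)(x)\,\mathrm d(\rho-\mu)(y)$. $\nabla K*\mu(x)=\int\nabla K(x-y)\,\mathrm d\mu(y)$. Lagrangian critical point. Use the convention $\nabla K(z)=-q|z|^{q-2}z$ for $z\ne0$ and $\nabla K(0):=0$. At every point $x$ where the integral is absolutely convergent, set $g_\rho(x):=\int\nabla K(x-y)\,\mathrm d(\rho-\mu)(y)$, and set $g_\rho(x):=0$ elsewhere. One requires that the integral converges absolutely for $\rho$-a.e. $x$ and that $g_\rho\in L^1_{\mathrm{loc}}(\rho)$. Then $\rho$ is a Lagrangian critical point of $E_\mu$ if $g_\rho=0$ $\rho$-a.e. (For $1<q<2$ the associated normalized potential $\int(K(x-y)-K(x_0-y))\,\mathrm d(\rho-\mu)(y)$ is well defined when $\rho,\mu\in\mathcal P_{q-1}(\mathbb R^d)$, which is the case here; for $0<q\le1$ it is always well defined.) *)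

theory Defs
  imports "HOL-Probability.Probability"
begin

subsection \<open>Probability measures, densities and narrow convergence\<close>

definition prob_measures :: "'a::euclidean_space measure set" where
  "prob_measures = {M. prob_space M \<and> sets M = sets borel}"

definition prob_measures_moment :: "real \<Rightarrow> 'a::euclidean_space measure set" where
  "prob_measures_moment s = {M \<in> prob_measures. integrable M (\<lambda>x. norm x powr s)}"

definition Lp_space :: "ereal \<Rightarrow> ('a::euclidean_space \<Rightarrow> real) set" where
  "Lp_space p = {f \<in> borel_measurable lborel.
     if p = \<infinity> then (\<exists>C. AE x in lborel. \<bar>f x\<bar> \<le> C)
     else integrable lborel (\<lambda>x. \<bar>f x\<bar> powr real_of_ereal p)}"

definition converges_narrowly ::
    "(nat \<Rightarrow> 'a::euclidean_space measure) \<Rightarrow> 'a measure \<Rightarrow> bool" where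
  "converges_narrowly R M \<longleftrightarrow>
     (\<forall>\<phi>::'a \<Rightarrow> real. continuous_on UNIV \<phi> \<and> bounded (range \<phi>) \<longrightarrow>
        (\<lambda>n. \<integral>x. \<phi> x \<partial>R n) \<longlonglongrightarrow> (\<integral>x. \<phi> x \<partial>M))"

text \<open>The sum \<open>(1/N) \<Sum>\<^sub>i \<delta>(x\<^sub>i)\<close>, written as the push-forward under \<open>x\<close> of the
  uniform distribution on the index set; see \<open>integral_empirical\<close> below.\<close>

definition empirical :: "nat \<Rightarrow> (nat \<Rightarrow> 'a::euclidean_space) \<Rightarrow> 'a measure" where
  "empirical N x = distr (uniform_count_measure {1..N}) borel x"

lemma integral_empirical:
  fixes \<phi> :: "'a::euclidean_space \<Rightarrow> real"
  assumes "\<phi> \<in> borel_measurable borel"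
  shows "(\<integral>z. \<phi> z \<partial>empirical N x) = (1 / real N) * (\<Sum>i\<in>{1..N}. \<phi> (x i))"
proof -
  have "x \<in> measurable (uniform_count_measure {1..N}) borel"
    by (simp add: measurable_def space_uniform_count_measure sets_uniform_count_measure)
  then have "(\<integral>z. \<phi> z \<partial>empirical N x) = (\<integral>i. \<phi> (x i) \<partial>uniform_count_measure {1..N})"
    unfolding empirical_def using assms by (rule integral_distr)
  also have "\<dots> = (\<Sum>i\<in>{1..N}. \<phi> (x i)) / real (card {1..N})"
    unfolding uniform_count_measure_def
    by (subst lebesgue_integral_point_measure_finite) (auto simp: sum_divide_distrib)
  finally show ?thesis by simp
qed

subsection \<open>Integration against a difference of two finite measures\<close>

text \<open>The Jordan decomposition of the signed measure \<open>M - N\<close>: its positive part is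
  \<open>(M \<squnion> N) - N\<close> and its negative part is \<open>(M \<squnion> N) - M\<close>, where \<open>\<squnion>\<close> is the supremum
  in the lattice of measures. Absolute convergence means integrability with
  respect to the total variation, that is, with respect to both parts.\<close>

definition signed_pos :: "'a measure \<Rightarrow> 'a measure \<Rightarrow> 'a measure" where
  "signed_pos M N = diff_measure (sup M N) N"

definition signed_neg :: "'a measure \<Rightarrow> 'a measure \<Rightarrow> 'a measure" where
  "signed_neg M N = diff_measure (sup M N) M"

definition signed_integrable ::
    "'a measure \<Rightarrow> 'a measure \<Rightarrow> ('a \<Rightarrow> 'b::{banach, second_countable_topology}) \<Rightarrow> bool" where
  "signed_integrable M N f \<longleftrightarrow>
     integrable (signed_pos M N) f \<and> integrable (signed_neg M N) f"

definition signed_integral ::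
    "'a measure \<Rightarrow> 'a measure \<Rightarrow> ('a \<Rightarrow> 'b::{banach, second_countable_topology}) \<Rightarrow> 'b" where
  "signed_integral M N f = (\<integral>x. f x \<partial>signed_pos M N) - (\<integral>x. f x \<partial>signed_neg M N)"

lemma emeasure_sup_eq_sup_measure':
  assumes "sets N = sets M"
  shows "sup M N = sup_measure' M N"
  using assms sets_eq_imp_space_eq[OF assms]
  by (simp add: sup_measure_def sup_lexord_def)

lemma sets_sup_eq: "sets N = sets M \<Longrightarrow> sets (sup M N) = sets M"
  by (simp add: emeasure_sup_eq_sup_measure')

lemma emeasure_sup_le_add:
  assumes "sets N = sets M" "A \<in> sets M"
  shows "emeasure (sup M N) A \<le> emeasure M A + emeasure N A"
  unfolding emeasure_sup_eq_sup_measure'[OF assms(1)] emeasure_sup_measure'[OF assms]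
  using assms by (intro SUP_least add_mono emeasure_mono) auto

lemma finite_measure_sup:
  assumes "finite_measure M" "finite_measure N" "sets N = sets M"
  shows "finite_measure (sup M N)"
proof
  interpret M: finite_measure M by fact
  interpret N: finite_measure N by fact
  have sp: "space (sup M N) = space M"
    using sets_sup_eq[OF assms(3)] by (rule sets_eq_imp_space_eq)
  have "emeasure (sup M N) (space M) \<le> emeasure M (space M) + emeasure N (space M)"
    using assms by (intro emeasure_sup_le_add) auto
  also have "\<dots> < \<infinity>"
    using M.emeasure_finite N.emeasure_finite by (simp add: less_top[symmetric])
  finally show "emeasure (sup M N) (space (sup M N)) \<noteq> \<infinity>"
    by (simp add: sp)
qed

context
  fixes M N :: "'a measure"
  assumes fin: "finite_measure M" "finite_measure N" and sets_eq: "sets N = sets M"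
begin

lemma emeasure_signed_pos:
  assumes "A \<in> sets M"
  shows "emeasure (signed_pos M N) A = emeasure (sup M N) A - emeasure N A"
  unfolding signed_pos_def
  using assms fin sets_eq sets_sup_eq[OF sets_eq]
  by (intro emeasure_diff_measure finite_measure_sup le_measureD3) auto

lemma emeasure_signed_neg:
  assumes "A \<in> sets M"
  shows "emeasure (signed_neg M N) A = emeasure (sup M N) A - emeasure M A"
  unfolding signed_neg_def
  using assms fin sets_eq sets_sup_eq[OF sets_eq]
  by (intro emeasure_diff_measure finite_measure_sup le_measureD3) auto

lemma sets_signed_pos: "sets (signed_pos M N) = sets M"
  and sets_signed_neg: "sets (signed_neg M N) = sets M"
  by (simp_all add: signed_pos_def signed_neg_def sets_sup_eq[OF sets_eq])

lemma emeasure_signed_balance: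
  assumes "A \<in> sets M"
  shows "emeasure (signed_pos M N) A + emeasure N A = emeasure (signed_neg M N) A + emeasure M A"
proof -
  have "emeasure N A \<le> emeasure (sup M N) A" "emeasure M A \<le> emeasure (sup M N) A"
    using assms sets_sup_eq[OF sets_eq] sets_eq by (auto intro!: le_measureD3)
  then show ?thesis
    by (simp add: emeasure_signed_pos emeasure_signed_neg assms diff_add_cancel_ennreal)
qed

lemma signed_pos_le: "signed_pos M N \<le> M"
proof -
  have "emeasure (signed_pos M N) A \<le> emeasure M A" if "A \<in> sets M" for A
    using emeasure_sup_le_add[OF sets_eq that]
      finite_measure.emeasure_finite[OF fin(1), of A] finite_measure.emeasure_finite[OF fin(2), of A]
    by (simp add: emeasure_signed_pos that ennreal_minus_le_iff add.commute)
  then show ?thesis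
    by (simp add: le_measure sets_signed_pos)
qed

lemma signed_neg_le: "signed_neg M N \<le> N"
proof -
  have "emeasure (signed_neg M N) A \<le> emeasure N A" if "A \<in> sets M" for A
    using emeasure_sup_le_add[OF sets_eq that]
      finite_measure.emeasure_finite[OF fin(1), of A] finite_measure.emeasure_finite[OF fin(2), of A]
    by (simp add: emeasure_signed_neg that ennreal_minus_le_iff add.commute)
  then show ?thesis
    by (simp add: le_measure sets_signed_neg sets_eq)
qed

lemma nn_integral_signed_balance:
  assumes "f \<in> borel_measurable M"
  shows "(\<integral>\<^sup>+x. f x \<partial>signed_pos M N) + (\<integral>\<^sup>+x. f x \<partial>N)
       = (\<integral>\<^sup>+x. f x \<partial>signed_neg M N) + (\<integral>\<^sup>+x. f x \<partial>M)"
proof -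
  note [measurable_cong] = sets_signed_pos sets_signed_neg sets_eq
  note spaces = sets_eq_imp_space_eq[OF sets_signed_pos] sets_eq_imp_space_eq[OF sets_signed_neg]
    sets_eq_imp_space_eq[OF sets_eq]
  show ?thesis
    using assms
  proof (induction rule: borel_measurable_induct)
    case (cong f g)
    then have "(\<integral>\<^sup>+x. f x \<partial>L) = (\<integral>\<^sup>+x. g x \<partial>L)" if "space L = space M" for L
      using that by (intro nn_integral_cong) auto
    with cong(4) show ?case
      by (simp add: spaces)
  next
    case (set A)
    then show ?case
      by (simp add: emeasure_signed_balance sets_signed_pos sets_signed_neg sets_eq)
  next
    case (mult u c)
    note [measurable] = mult(2)
    from mult show ?case
      by (simp add: nn_integral_cmult distrib_left[symmetric])
  next
    case (add u v)
    note [measurable] = add(1,4)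
    from add show ?case
      by (simp add: nn_integral_add ac_simps)
  next
    case (seq U)
    note [measurable] = seq(1)
    have sup: "(\<integral>\<^sup>+x. (SUP i. U i) x \<partial>L) = (SUP i. \<integral>\<^sup>+x. U i x \<partial>L)"
      if "sets L = sets M" for L
      using seq that measurable_cong_sets[OF that refl]
      by (simp add: image_comp nn_integral_monotone_convergence_SUP)
    have inc: "incseq (\<lambda>i. \<integral>\<^sup>+x. U i x \<partial>L)" for L
      using seq by (intro incseq_nn_integral)
    show ?case
      by (simp only: sup sets_signed_pos sets_signed_neg sets_eq
          ennreal_SUP_add[OF inc inc, symmetric] seq)
  qed
qed

end

text \<open>For functions integrable with respect to both measures, the signed integral is
  the difference of the two integrals.\<close>

lemma integrable_le_measure:
  fixes f :: "'a \<Rightarrow> 'b::{banach, second_countable_topology}"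
  assumes "L \<le> M" "sets L = sets M" "integrable M f"
  shows "integrable L f"
proof (rule integrableI_bounded)
  show "f \<in> borel_measurable L"
    using assms measurable_cong_sets[OF assms(2) refl] by auto
  have "(\<integral>\<^sup>+x. norm (f x) \<partial>L) \<le> (\<integral>\<^sup>+x. norm (f x) \<partial>M)"
    using assms by (intro nn_integral_mono_measure) auto
  also have "\<dots> < \<infinity>"
    using assms(3) by (simp add: integrable_iff_bounded)
  finally show "(\<integral>\<^sup>+x. norm (f x) \<partial>L) < \<infinity>" .
qed

lemma signed_integrableI:
  fixes f :: "'a \<Rightarrow> 'b::{banach, second_countable_topology}"
  assumes "finite_measure M" "finite_measure N" "sets N = sets M"
    and "integrable M f" "integrable N f"
  shows "signed_integrable M N f"
  unfolding signed_integrable_def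
  using assms integrable_le_measure[OF signed_pos_le[OF assms(1-3)]]
    integrable_le_measure[OF signed_neg_le[OF assms(1-3)]]
    sets_signed_pos[OF assms(1-3)] sets_signed_neg[OF assms(1-3)]
  by auto

lemma signed_integral_eq_diff_real:
  fixes f :: "'a \<Rightarrow> real"
  assumes "finite_measure M" "finite_measure N" "sets N = sets M"
    and "integrable M f" "integrable N f"
  shows "signed_integral M N f = (\<integral>x. f x \<partial>M) - (\<integral>x. f x \<partial>N)"
proof -
  have int: "integrable (signed_pos M N) f" "integrable (signed_neg M N) f"
    using signed_integrableI[OF assms] by (auto simp: signed_integrable_def)
  have bal: "enn2real (\<integral>\<^sup>+x. ennreal (g x) \<partial>signed_pos M N) + enn2real (\<integral>\<^sup>+x. ennreal (g x) \<partial>N)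
       = enn2real (\<integral>\<^sup>+x. ennreal (g x) \<partial>signed_neg M N) + enn2real (\<integral>\<^sup>+x. ennreal (g x) \<partial>M)"
    if g: "g = f \<or> g = (\<lambda>x. - f x)" for g
  proof -
    have gi: "integrable L g" if "integrable L f" for L
      using g that by auto
    have fin: "(\<integral>\<^sup>+x. ennreal (g x) \<partial>L) < top" if "integrable L f" for L
    proof -
      have "(\<integral>\<^sup>+x. ennreal (g x) \<partial>L) \<le> (\<integral>\<^sup>+x. ennreal (norm (g x)) \<partial>L)"
        by (intro nn_integral_mono ennreal_leI) simp
      also have "\<dots> < top"
        using gi[OF that] by (simp add: integrable_iff_bounded)
      finally show ?thesis .
    qed
    have "(\<lambda>x. ennreal (g x)) \<in> borel_measurable M"
      using gi[OF assms(4)] by measurable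
    from nn_integral_signed_balance[OF assms(1-3) this]
    show ?thesis
      using fin[OF assms(4)] fin[OF assms(5)] fin[OF int(1)] fin[OF int(2)]
      by (metis enn2real_plus)
  qed
  show ?thesis
    unfolding signed_integral_def
    using bal[of f] bal[of "\<lambda>x. - f x"]
    by (simp add: real_lebesgue_integral_def int assms)
qed

lemma signed_integral_eq_diff:
  fixes f :: "'a \<Rightarrow> 'b::euclidean_space"
  assumes "finite_measure M" "finite_measure N" "sets N = sets M"
    and "integrable M f" "integrable N f"
  shows "signed_integral M N f = (\<integral>x. f x \<partial>M) - (\<integral>x. f x \<partial>N)"
proof (rule euclidean_eqI)
  fix b :: 'b
  have int: "integrable (signed_pos M N) f" "integrable (signed_neg M N) f"
    using signed_integrableI[OF assms] by (auto simp: signed_integrable_def)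
  show "signed_integral M N f \<bullet> b = ((\<integral>x. f x \<partial>M) - (\<integral>x. f x \<partial>N)) \<bullet> b"
    using signed_integral_eq_diff_real[OF assms(1-3), of "\<lambda>x. f x \<bullet> b"] int assms(4,5)
    by (simp add: signed_integral_def inner_diff_left)
qed

subsection \<open>The kernel and Lagrangian critical points\<close>

definition kernel :: "real \<Rightarrow> 'a::euclidean_space \<Rightarrow> real" where
  "kernel q z = - (norm z powr q)"

definition grad_kernel :: "real \<Rightarrow> 'a::euclidean_space \<Rightarrow> 'a" where
  "grad_kernel q z = (if z = 0 then 0 else - (q * norm z powr (q - 2)) *\<^sub>R z)"

lemma kernel_has_gradient:
  fixes z :: "'a::euclidean_space"
  assumes "z \<noteq> 0"
  shows "(kernel q has_derivative (\<lambda>h. grad_kernel q z \<bullet> h)) (at z)"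
proof -
  have "((\<lambda>z. - (norm z powr q)) has_derivative
      (\<lambda>h. - (q * norm z powr (q - 1) * (sgn z \<bullet> h)))) (at z)"
    using assms
    by (auto intro!: derivative_eq_intros has_derivative_norm
        simp: inner_commute fun_eq_iff powr_diff)
  moreover have "norm z powr (q - 1) / norm z = norm z powr (q - 2)"
    using assms powr_diff[of "norm z" "q - 1" 1] by simp
  then have "- (q * norm z powr (q - 1) * (sgn z \<bullet> h)) = grad_kernel q z \<bullet> h" for h
    using assms by (simp add: grad_kernel_def sgn_div_norm divide_inverse)
  ultimately show ?thesis
    by (simp add: kernel_def[abs_def])
qed

definition mmd_gradient ::
    "real \<Rightarrow> 'a::euclidean_space measure \<Rightarrow> 'a measure \<Rightarrow> 'a \<Rightarrow> 'a" where
  "mmd_gradient q \<mu> \<rho> x =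
     (if signed_integrable \<rho> \<mu> (\<lambda>y. grad_kernel q (x - y))
      then signed_integral \<rho> \<mu> (\<lambda>y. grad_kernel q (x - y))
      else 0)"

text \<open>Lagrangian critical points of \<open>\<rho> \<mapsto> MMD\<^sub>q\<^sup>2(\<rho>, \<mu>)\<close>. The second conjunct states
  that the gradient belongs to \<open>L\<^sup>1\<^sub>l\<^sub>o\<^sub>c(\<rho>)\<close>.\<close>

definition lagrangian_critical_point ::
    "real \<Rightarrow> 'a::euclidean_space measure \<Rightarrow> 'a measure \<Rightarrow> bool" where
  "lagrangian_critical_point q \<mu> \<rho> \<longleftrightarrow>
     (AE x in \<rho>. signed_integrable \<rho> \<mu> (\<lambda>y. grad_kernel q (x - y))) \<and>
     (\<forall>C. compact C \<longrightarrow> set_integrable \<rho> C (mmd_gradient q \<mu> \<rho>)) \<and>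
     (AE x in \<rho>. mmd_gradient q \<mu> \<rho> x = 0)"

definition particle_residual ::
    "real \<Rightarrow> 'a::euclidean_space measure \<Rightarrow> nat \<Rightarrow> (nat \<Rightarrow> 'a) \<Rightarrow> nat \<Rightarrow> 'a" where
  "particle_residual q \<mu> N x i =
     - (1 / real N) *\<^sub>R (\<Sum>j\<in>{1..N} - {i}. grad_kernel q (x i - x j))
     + (\<integral>y. grad_kernel q (x i - y) \<partial>\<mu>)"

end

theory Submission
  imports Defs
begin

text \<open>
  Testing the residuals against a bounded Lipschitz function \<open>\<psi>\<close> and a direction \<open>e\<close> gives
  averages that vanish in the limit, by Cauchy--Schwarz. Each average is the difference of two terms.
  The first integrates \<open>\<psi>\<close> times the force \<open>\<nabla>K * \<mu>\<close> against the empirical measure. The second is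
  a double sum over pairs of particles; since \<open>\<nabla>K\<close> is odd, it equals half of the double
  integral of \<open>(\<psi>(x) - \<psi>(y)) (\<nabla>K(x - y) \<bullet> e)\<close>. The Lipschitz factor gains one power of \<open>|x - y|\<close>,
  so this symmetrised integrand has size \<open>|x - y|^q\<close> near the diagonal: it is continuous even though
  \<open>\<nabla>K\<close> is singular for \<open>q < 1\<close> and discontinuous for \<open>q = 1\<close> (\<open>interaction_continuous\<close>).

  Narrow convergence passes to the product measures (\<open>narrow_pair\<close>), so both terms converge once
  their integrands are continuous and of controlled growth (\<open>narrow_integral_tendsto\<close>). For the
  first term this is where the integrability of the density enters. The condition on \<open>p\<close> leaves
  room for an exponent \<open>b > 1 - q\<close> for which \<open>\<integral> |x - y|^(-b) d\<mu>(y)\<close> is bounded in \<open>x\<close>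
  (\<open>singularity_exponent\<close>, \<open>riesz_potential_bounded\<close>); as \<open>|\<nabla>K(z)|\<close> is of smaller order than
  \<open>|z|^(-b)\<close> at the origin, \<open>\<nabla>K * \<mu>\<close> is a uniform limit of continuous functions
  (\<open>target_force_continuous\<close>). All functions involved grow at most like \<open>|x|^(max 0 (q - 1))\<close>, and
  a moment of order larger than \<open>q - 1\<close> makes this uniformly integrable along the sequence.

  The limit identity (\<open>weak_form\<close>) still contains the symmetrised kernel. Undoing the
  symmetrisation requires \<open>\<nabla>K(x - y)\<close> to be integrable for \<open>\<rho> \<otimes> \<rho>\<close>. For \<open>q \<ge> 1\<close> this follows
  from the moments, for \<open>q < 1\<close> from the energy bound, which is inherited by the limit after
  regularisation at the diagonal (\<open>pair_force_integrable\<close>). Fubini's theorem then yields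
  \<open>\<integral> \<psi> (g \<bullet> e) d\<rho> = 0\<close> for the gradient \<open>g\<close> and all \<open>\<psi>\<close>, \<open>e\<close>, hence \<open>g = 0\<close> almost everywhere.
\<close>

section \<open>Narrow convergence\<close>

lemma prob_measuresD:
  assumes "M \<in> prob_measures"
  shows "prob_space M" "sets M = sets borel"
  using assms by (auto simp: prob_measures_def)

lemma integrable_continuous_bounded:
  fixes G :: "'a::euclidean_space \<Rightarrow> real"
  assumes "M \<in> prob_measures" "continuous_on UNIV G" "\<And>x. \<bar>G x\<bar> \<le> B"
  shows "integrable M G"
proof -
  interpret prob_space M using prob_measuresD assms by blast
  have "G \<in> borel_measurable M"
    using borel_measurable_continuous_onI[OF assms(2)] prob_measuresD(2)[OF assms(1)]
      measurable_cong_sets by blast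
  then show ?thesis
    using assms(3) by (intro integrable_const_bound[where B=B]) auto
qed

text \<open>
  A moment is the supremum of the integrals of its truncations at height \<open>T\<close>, and each truncation is
  an admissible test function for narrow convergence.
\<close>

lemma narrow_moment_bound:
  fixes w :: "'a::euclidean_space \<Rightarrow> real"
  assumes narrow: "converges_narrowly P M"
    and P: "\<And>n. nmin \<le> n \<Longrightarrow> P n \<in> prob_measures" and M: "M \<in> prob_measures"
    and w: "continuous_on UNIV w" "\<And>x. 0 \<le> w x"
    and bound: "\<And>n. nmin \<le> n \<Longrightarrow> integrable (P n) w" "\<And>n. nmin \<le> n \<Longrightarrow> (\<integral>x. w x \<partial>P n) \<le> S"
  shows "integrable M w" "(\<integral>x. w x \<partial>M) \<le> S"
proof -
  interpret prob_space M using prob_measuresD M by blast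
  have wm[measurable]: "w \<in> borel_measurable M"
    using borel_measurable_continuous_onI[OF w(1)] prob_measuresD(2)[OF M]
      measurable_cong_sets by blast
  have S: "(\<integral>x. min (w x) (real T) \<partial>M) \<le> S" for T :: nat
  proof (rule LIMSEQ_le_const2)
    have c: "continuous_on UNIV (\<lambda>x. min (w x) (real T))"
      using w(1) by (intro continuous_intros)
    moreover have b: "\<bar>min (w x) (real T)\<bar> \<le> real T" for x using w(2)[of x] by auto
    ultimately show "(\<lambda>n. \<integral>x. min (w x) (real T) \<partial>P n) \<longlonglongrightarrow> (\<integral>x. min (w x) (real T) \<partial>M)"
      using narrow unfolding converges_narrowly_def by (force simp: bounded_iff)
    have "(\<integral>x. min (w x) (real T) \<partial>P n) \<le> S" if "nmin \<le> n" for n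
      using bound(2)[OF that] integral_mono[OF integrable_continuous_bounded[OF P[OF that] c b] bound(1)[OF that]]
      by force
    then show "\<exists>N. \<forall>n\<ge>N. (\<integral>x. min (w x) (real T) \<partial>P n) \<le> S" by blast
  qed
  have int: "integrable M (\<lambda>x. min (w x) (real T))" for T :: nat
    using w(2) by (intro integrable_const_bound[where B="real T"]) auto
  have "0 \<le> (\<integral>x. min (w x) (real 0) \<partial>M)" by (rule Bochner_Integration.integral_nonneg) (use w in auto)
  then have S0: "0 \<le> S" using S[of 0] by simp
  have "(\<integral>\<^sup>+x. ennreal (w x) \<partial>M) = (\<integral>\<^sup>+x. (SUP T. ennreal (min (w x) (real T))) \<partial>M)"
  proof (intro nn_integral_cong antisym SUP_least)
    fix x
    obtain T :: nat where "w x \<le> real T" using real_arch_simple by blast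
    then have "ennreal (w x) = ennreal (min (w x) (real T))" by simp
    then show "ennreal (w x) \<le> (SUP T. ennreal (min (w x) (real T)))"
      using SUP_upper[of T UNIV "\<lambda>T. ennreal (min (w x) (real T))"] by (simp only: UNIV_I)
  qed (auto intro: ennreal_leI)
  also have "\<dots> = (SUP T. \<integral>\<^sup>+x. ennreal (min (w x) (real T)) \<partial>M)"
    by (intro nn_integral_monotone_convergence_SUP)
       (auto simp: incseq_def le_fun_def intro!: ennreal_leI)
  also have "\<dots> \<le> ennreal S"
  proof (rule SUP_least)
    fix T :: nat
    have "(\<integral>\<^sup>+x. ennreal (min (w x) (real T)) \<partial>M) = ennreal (\<integral>x. min (w x) (real T) \<partial>M)"
      using w(2) by (intro nn_integral_eq_integral int) auto
    then show "(\<integral>\<^sup>+x. ennreal (min (w x) (real T)) \<partial>M) \<le> ennreal S"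
      using S[of T] by (simp add: ennreal_leI)
  qed
  finally have le: "(\<integral>\<^sup>+x. ennreal (w x) \<partial>M) \<le> ennreal S" .
  show "integrable M w"
    using le w(2) by (intro integrableI_bounded) (auto simp: le_less_trans)
  then show "(\<integral>x. w x \<partial>M) \<le> S"
    using le w(2) S0 by (subst integral_eq_nn_integral) (auto intro: enn2real_leI)
qed

text \<open>
  Narrow convergence handles bounded test functions only. A bound on the moment of order \<open>s > 1\<close> of
  \<open>G\<close> makes \<open>G\<close> uniformly integrable: cutting \<open>G\<close> off at height \<open>T\<close> changes all integrals by at
  most \<open>T\<close> to the power \<open>1 - s\<close> times the bound.
\<close>

lemma narrow_integral_tendsto:
  fixes G w :: "'a::euclidean_space \<Rightarrow> real"
  assumes narrow: "converges_narrowly P M"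
    and P: "\<And>n. nmin \<le> n \<Longrightarrow> P n \<in> prob_measures" and M: "M \<in> prob_measures"
    and w: "continuous_on UNIV w"
    and bound: "\<And>n. nmin \<le> n \<Longrightarrow> integrable (P n) w" "\<And>n. nmin \<le> n \<Longrightarrow> (\<integral>x. w x \<partial>P n) \<le> S"
    and G: "continuous_on UNIV G" and s: "1 < s" and Gw: "\<And>x. \<bar>G x\<bar> powr s \<le> w x"
  shows "(\<lambda>n. \<integral>x. G x \<partial>P n) \<longlonglongrightarrow> (\<integral>x. G x \<partial>M)"
proof -
  have w0: "0 \<le> w x" for x using Gw[of x] powr_ge_zero[of "\<bar>G x\<bar>" s] by linarith
  note Mw = narrow_moment_bound[of P M nmin w S, OF narrow P M w w0 bound]
  define cl where "cl T x = max (- T) (min T (G x))" for T x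
  have cl_cont: "continuous_on UNIV (cl T)" for T
    unfolding cl_def using G by (intro continuous_intros)
  have cl_bd: "\<bar>cl T x\<bar> \<le> T" if "0 \<le> T" for T x using that by (auto simp: cl_def)
  have diff: "\<bar>G x - cl T x\<bar> \<le> T powr (1 - s) * w x" if "1 \<le> T" for T x
  proof (cases "\<bar>G x\<bar> \<le> T")
    case True
    then have "G x - cl T x = 0" using that by (auto simp: cl_def)
    then show ?thesis using w0 by simp
  next
    case False
    then have "\<bar>G x - cl T x\<bar> \<le> \<bar>G x\<bar>" using that by (auto simp: cl_def)
    also have "\<bar>G x\<bar> = \<bar>G x\<bar> powr (1 - s) * \<bar>G x\<bar> powr s"
      using False that by (simp flip: powr_add)
    also have "\<dots> \<le> T powr (1 - s) * w x"
      using False that s by (intro mult_mono Gw powr_mono2') auto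
    finally show ?thesis .
  qed
  have est: "\<bar>(\<integral>x. G x \<partial>Q) - (\<integral>x. cl T x \<partial>Q)\<bar> \<le> T powr (1 - s) * S"
    if Q: "Q \<in> prob_measures" "integrable Q w" "(\<integral>x. w x \<partial>Q) \<le> S" and T: "1 \<le> T" for Q T
  proof -
    interpret Q: prob_space Q using prob_measuresD Q by blast
    have [measurable]: "G \<in> borel_measurable Q"
      using borel_measurable_continuous_onI[OF G] prob_measuresD(2)[OF Q(1)]
        measurable_cong_sets by blast
    have icl: "integrable Q (cl T)"
      by (rule integrable_continuous_bounded[OF Q(1) cl_cont cl_bd]) (use T in auto)
    have idiff: "integrable Q (\<lambda>x. G x - cl T x)"
      by (rule Bochner_Integration.integrable_bound[of Q "\<lambda>x. T powr (1 - s) * w x"])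
         (use Q diff[OF T] icl in \<open>auto intro!: AE_I2 order_trans[OF diff[OF T]]\<close>)
    then have iG: "integrable Q G" using Bochner_Integration.integrable_add[OF idiff icl] by simp
    have "\<bar>(\<integral>x. G x \<partial>Q) - (\<integral>x. cl T x \<partial>Q)\<bar> = \<bar>\<integral>x. G x - cl T x \<partial>Q\<bar>"
      using iG icl by simp
    also have "\<dots> \<le> (\<integral>x. \<bar>G x - cl T x\<bar> \<partial>Q)" by (rule integral_abs_bound)
    also have "\<dots> \<le> (\<integral>x. T powr (1 - s) * w x \<partial>Q)"
      using idiff Q diff[OF T] by (intro integral_mono) auto
    also have "\<dots> \<le> T powr (1 - s) * S" using Q by (auto intro: mult_left_mono)
    finally show ?thesis .
  qed
  show ?thesis
  proof (rule tendstoI)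
    fix e :: real assume e: "0 < e"
    have "((\<lambda>T::real. T powr (1 - s) * S) \<longlongrightarrow> 0 * S) at_top"
      using s by (intro tendsto_intros tendsto_neg_powr filterlim_ident) auto
    then have "eventually (\<lambda>T::real. T powr (1 - s) * S < e / 3) at_top"
      using e by (auto dest!: order_tendstoD(2)[where a="e/3"])
    then have "eventually (\<lambda>T::real. T powr (1 - s) * S < e / 3 \<and> 1 \<le> T) at_top"
      using eventually_ge_at_top by (rule eventually_conj)
    then obtain T where T: "T powr (1 - s) * S < e / 3" "1 \<le> T"
      by (auto simp: eventually_at_top_linorder)
    have "(\<lambda>n. \<integral>x. cl T x \<partial>P n) \<longlonglongrightarrow> (\<integral>x. cl T x \<partial>M)"
    proof -
      have "bounded (range (cl T))" using cl_bd[of T] T unfolding bounded_iff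
        by (intro exI[of _ T]) auto
      then show ?thesis using narrow cl_cont unfolding converges_narrowly_def by blast
    qed
    then have "eventually (\<lambda>n. dist (\<integral>x. cl T x \<partial>P n) (\<integral>x. cl T x \<partial>M) < e / 3) sequentially"
      using e by (intro tendstoD) auto
    then show "eventually (\<lambda>n. dist (\<integral>x. G x \<partial>P n) (\<integral>x. G x \<partial>M) < e) sequentially"
      using eventually_ge_at_top[of nmin]
    proof eventually_elim
      case (elim n)
      then show ?case
        using est[OF P bound T(2), of n] est[OF M Mw T(2)] T(1) unfolding dist_real_def by linarith
    qed
  qed
qed

lemma pair_prob_measures:
  assumes "M \<in> prob_measures" "N \<in> prob_measures"
  shows "M \<Otimes>\<^sub>M N \<in> (prob_measures :: ('a::euclidean_space \<times> 'b::euclidean_space) measure set)"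
proof -
  interpret M: prob_space M using prob_measuresD assms by blast
  interpret N: prob_space N using prob_measuresD assms by blast
  interpret MN: pair_prob_space M N ..
  have "sets (M \<Otimes>\<^sub>M N) = sets (borel \<Otimes>\<^sub>M borel :: ('a \<times> 'b) measure)"
    using prob_measuresD(2)[OF assms(1)] prob_measuresD(2)[OF assms(2)]
    by (rule sets_pair_measure_cong)
  then have "sets (M \<Otimes>\<^sub>M N) = sets borel"
    by (simp only: borel_prod)
  then show ?thesis using MN.prob_space_axioms by (simp add: prob_measures_def)
qed

definition cutoff :: "real \<Rightarrow> 'a::euclidean_space \<Rightarrow> real" where
  "cutoff R x = max 0 (min 1 (R + 1 - norm x))"

lemma cutoff_props:
  "continuous_on UNIV (cutoff R)" "0 \<le> cutoff R x" "cutoff R x \<le> 1"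
  "R + 1 \<le> norm x \<Longrightarrow> cutoff R x = 0"
  by (auto simp: cutoff_def[abs_def] intro!: continuous_intros)

lemma cutoff_tail:
  fixes M :: "'a::euclidean_space measure"
  assumes M: "M \<in> prob_measures" and e: "0 < e"
  obtains R where "(\<integral>x. 1 - cutoff R x \<partial>M) < e"
proof -
  interpret prob_space M using prob_measuresD M by blast
  have [measurable]: "cutoff R \<in> borel_measurable M" for R :: real
    using borel_measurable_continuous_onI[OF cutoff_props(1)] prob_measuresD(2)[OF M]
        measurable_cong_sets by blast
  have "(\<lambda>n. \<integral>x. 1 - cutoff (real n) x \<partial>M) \<longlonglongrightarrow> (\<integral>x. 0 \<partial>M)"
  proof (rule integral_dominated_convergence[where w="\<lambda>_. 1"])
    show "AE x in M. (\<lambda>n. 1 - cutoff (real n) x) \<longlonglongrightarrow> 0"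
    proof (rule AE_I2)
      fix x :: 'a
      obtain k :: nat where "norm x \<le> real k" using real_arch_simple by blast
      then have "\<And>n. k \<le> n \<Longrightarrow> 1 - cutoff (real n) x = 0" by (auto simp: cutoff_def)
      then show "(\<lambda>n. 1 - cutoff (real n) x) \<longlonglongrightarrow> 0"
        by (intro tendsto_eventually) (auto simp: eventually_at_top_linorder)
    qed
  qed (auto simp: cutoff_props)
  then have "eventually (\<lambda>n. (\<integral>x. 1 - cutoff (real n) x \<partial>M) < e) sequentially"
    using e by (auto dest: order_tendstoD(2))
  then show ?thesis using that by (auto simp: eventually_at_top_linorder)
qed

text \<open>
  The partial integrals \<open>F Q x = \<integral> G (x, y) dQ(y)\<close> are equicontinuous in \<open>x\<close>, uniformly in the
  probability measure \<open>Q\<close>. Hence their pointwise convergence on a finite net of the compact set is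
  uniform, and the inner measure may be replaced by its limit before the outer one.
\<close>

lemma narrow_pair_compact:
  fixes G :: "'a::euclidean_space \<times> 'a \<Rightarrow> real"
  assumes narrow: "converges_narrowly P M"
    and P: "\<And>n. nmin \<le> n \<Longrightarrow> P n \<in> prob_measures" and M: "M \<in> prob_measures"
    and G: "continuous_on UNIV G" "\<And>z. \<bar>G z\<bar> \<le> B"
    and K: "compact K" "\<And>x y. x \<notin> K \<or> y \<notin> K \<Longrightarrow> G (x, y) = 0"
  shows "(\<lambda>n. \<integral>z. G z \<partial>(P n \<Otimes>\<^sub>M P n)) \<longlonglongrightarrow> (\<integral>z. G z \<partial>(M \<Otimes>\<^sub>M M))"
proof -
  define F where "F Q x = (\<integral>y. G (x, y) \<partial>Q)" for Q :: "'a measure" and x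
  have slice: "continuous_on UNIV (\<lambda>y. G (x, y))" for x
    by (intro continuous_on_compose2[OF G(1)] continuous_intros) auto
  have slice': "continuous_on UNIV (\<lambda>x. G (x, y))" for y
    by (intro continuous_on_compose2[OF G(1)] continuous_intros) auto
  have islice: "integrable Q (\<lambda>y. G (x, y))" if "Q \<in> prob_measures" for Q x
    using integrable_continuous_bounded[OF that slice] G(2) by blast
  have Fub: "(\<integral>z. G z \<partial>(Q \<Otimes>\<^sub>M Q)) = (\<integral>x. F Q x \<partial>Q)" if Q: "Q \<in> prob_measures" for Q
  proof -
    interpret Q: prob_space Q using prob_measuresD Q by blast
    interpret QQ: pair_sigma_finite Q Q ..
    have "integrable (Q \<Otimes>\<^sub>M Q) G"
      using integrable_continuous_bounded[OF pair_prob_measures[OF Q Q] G] .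
    then show ?thesis using QQ.integral_fst'[of G] by (simp add: F_def)
  qed
  have Fdiff: "\<bar>F Q x - F Q x'\<bar> \<le> e"
    if Q: "Q \<in> prob_measures" and e: "\<And>y. \<bar>G (x, y) - G (x', y)\<bar> \<le> e" for Q x x' e
  proof -
    interpret Q: prob_space Q using prob_measuresD Q by blast
    have "\<bar>F Q x - F Q x'\<bar> = \<bar>\<integral>y. G (x, y) - G (x', y) \<partial>Q\<bar>"
      using islice[OF Q] by (simp add: F_def)
    also have "\<dots> \<le> (\<integral>y. \<bar>G (x, y) - G (x', y)\<bar> \<partial>Q)" by (rule integral_abs_bound)
    also have "\<dots> \<le> (\<integral>y. e \<partial>Q)"
      using islice[OF Q] e by (intro integral_mono) auto
    finally show ?thesis using Q.prob_space by simp
  qed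
  have Fbd: "\<bar>F Q x\<bar> \<le> B" if Q: "Q \<in> prob_measures" for Q x
  proof -
    interpret Q: prob_space Q using prob_measuresD Q by blast
    have "\<bar>F Q x\<bar> \<le> (\<integral>y. \<bar>G (x, y)\<bar> \<partial>Q)" unfolding F_def by (rule integral_abs_bound)
    also have "\<dots> \<le> (\<integral>y. B \<partial>Q)"
      using islice[OF Q] G(2) by (intro integral_mono) auto
    finally show ?thesis using Q.prob_space by simp
  qed
  have Fcont: "continuous_on UNIV (F Q)" if Q: "Q \<in> prob_measures" for Q
  proof (rule continuous_at_imp_continuous_on, rule ballI, rule continuous_at_sequentiallyI)
    interpret Q: prob_space Q using prob_measuresD Q by blast
    fix x and u :: "nat \<Rightarrow> 'a" assume u: "u \<longlonglongrightarrow> x"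
    show "(\<lambda>n. F Q (u n)) \<longlonglongrightarrow> F Q x"
      unfolding F_def
    proof (rule integral_dominated_convergence[where w="\<lambda>_. B"])
      show "AE y in Q. (\<lambda>n. G (u n, y)) \<longlonglongrightarrow> G (x, y)"
        using continuous_on_tendsto_compose[OF slice' u] by auto
    qed (use islice[OF Q] G(2) in \<open>auto dest: borel_measurable_integrable\<close>)
  qed
  have unif: "eventually (\<lambda>n. \<forall>x. \<bar>F (P n) x - F M x\<bar> \<le> 3 * e) sequentially" if e: "0 < e" for e
  proof -
    have "uniformly_continuous_on (K \<times> K) G"
      using K(1) by (intro compact_uniformly_continuous continuous_on_subset[OF G(1)] compact_Times) auto
    then obtain d where d: "0 < d"
      "\<And>z z'. z \<in> K \<times> K \<Longrightarrow> z' \<in> K \<times> K \<Longrightarrow> dist z' z < d \<Longrightarrow> dist (G z') (G z) < e"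
      using e unfolding uniformly_continuous_on_def by metis
    have Gd: "\<bar>G (x, y) - G (x', y)\<bar> \<le> e" if "x \<in> K" "x' \<in> K" "dist x x' < d" for x x' y
      using d(2)[of "(x', y)" "(x, y)"] that K(2) e
      by (cases "y \<in> K") (auto simp: dist_Pair_Pair dist_real_def)
    obtain k where k: "finite k" "k \<subseteq> K" "K \<subseteq> (\<Union>x\<in>k. ball x d)"
      using seq_compact_imp_totally_bounded[of K] K(1) d(1) compact_imp_seq_compact by metis
    have "eventually (\<lambda>n. \<forall>x\<in>k. \<bar>F (P n) x - F M x\<bar> < e) sequentially"
    proof (intro eventually_ball_finite k ballI)
      fix x
      have "bounded (range (\<lambda>y. G (x, y)))" using G(2) by (auto simp: bounded_iff)
      then have "(\<lambda>n. F (P n) x) \<longlonglongrightarrow> F M x"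
        using narrow slice unfolding converges_narrowly_def F_def by blast
      then show "eventually (\<lambda>n. \<bar>F (P n) x - F M x\<bar> < e) sequentially"
        using e by (auto dest!: tendstoD simp: dist_real_def)
    qed
    then show ?thesis using eventually_ge_at_top[of nmin]
    proof eventually_elim
      case (elim n)
      show ?case
      proof
        fix x
        show "\<bar>F (P n) x - F M x\<bar> \<le> 3 * e"
        proof (cases "x \<in> K")
          case False then show ?thesis using K(2) e by (simp add: F_def)
        next
          case True
          then obtain x' where x': "x' \<in> k" "dist x x' < d" using k(3) by (force simp: dist_commute)
          have "\<bar>F (P n) x - F (P n) x'\<bar> \<le> e" "\<bar>F M x - F M x'\<bar> \<le> e"
            using Fdiff P[OF elim(2)] M Gd[OF True _ x'(2)] x'(1) k(2) by blast+
          then show ?thesis using elim(1) x'(1) by force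
        qed
      qed
    qed
  qed
  have lim: "(\<lambda>n. \<integral>x. F (P n) x \<partial>P n) \<longlonglongrightarrow> (\<integral>x. F M x \<partial>M)"
  proof (rule tendstoI)
    fix e :: real assume e: "0 < e"
    have "bounded (range (F M))" using Fbd[OF M] by (auto simp: bounded_iff)
    then have "(\<lambda>n. \<integral>x. F M x \<partial>P n) \<longlonglongrightarrow> (\<integral>x. F M x \<partial>M)"
      using narrow Fcont[OF M] unfolding converges_narrowly_def by blast
    then have "eventually (\<lambda>n. dist (\<integral>x. F M x \<partial>P n) (\<integral>x. F M x \<partial>M) < e / 2) sequentially"
      using e by (auto dest!: tendstoD[where e="e/2"])
    moreover have "eventually (\<lambda>n. \<forall>x. \<bar>F (P n) x - F M x\<bar> \<le> 3 * (e / 12)) sequentially"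
      using e by (intro unif) simp
    ultimately show "eventually (\<lambda>n. dist (\<integral>x. F (P n) x \<partial>P n) (\<integral>x. F M x \<partial>M) < e) sequentially"
      using eventually_ge_at_top[of nmin]
    proof eventually_elim
      case (elim n)
      interpret Pn: prob_space "P n" using prob_measuresD P elim(3) by blast
      have i: "integrable (P n) (F (P n))" "integrable (P n) (F M)"
        using integrable_continuous_bounded[OF P[OF elim(3)] Fcont Fbd] P[OF elim(3)] M by blast+
      have "\<bar>(\<integral>x. F (P n) x \<partial>P n) - (\<integral>x. F M x \<partial>P n)\<bar> = \<bar>\<integral>x. F (P n) x - F M x \<partial>P n\<bar>"
        using i by simp
      also have "\<dots> \<le> (\<integral>x. \<bar>F (P n) x - F M x\<bar> \<partial>P n)" by (rule integral_abs_bound)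
      also have "\<dots> \<le> (\<integral>x. 3 * (e / 12) \<partial>P n)"
        using i elim(2) by (intro integral_mono) auto
      also have "\<dots> = e / 4" using Pn.prob_space by simp
      finally show ?case using elim(1) e unfolding dist_real_def by linarith
    qed
  qed
  have "eventually (\<lambda>n. (\<integral>x. F (P n) x \<partial>P n) = (\<integral>z. G z \<partial>(P n \<Otimes>\<^sub>M P n))) sequentially"
    using eventually_ge_at_top[of nmin] by eventually_elim (simp add: Fub P)
  from Lim_transform_eventually[OF lim this] show ?thesis by (simp add: Fub[OF M])
qed

text \<open>
  The general case is reduced to compact support by multiplying with a cutoff in each variable. The
  mass that this removes is small for the limit measure, and therefore eventually for the
  sequence, because the cutoff itself is an admissible test function.
\<close>

lemma narrow_pair:
  fixes M :: "'a::euclidean_space measure"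
  assumes narrow: "converges_narrowly P M"
    and P: "\<And>n. nmin \<le> n \<Longrightarrow> P n \<in> prob_measures" and M: "M \<in> prob_measures"
  shows "converges_narrowly (\<lambda>n. P n \<Otimes>\<^sub>M P n) (M \<Otimes>\<^sub>M M)"
  unfolding converges_narrowly_def
proof (intro allI impI tendstoI)
  fix G :: "'a \<times> 'a \<Rightarrow> real" and e :: real
  assume G: "continuous_on UNIV G \<and> bounded (range G)" and e: "0 < e"
  then obtain B0 where "\<And>z. \<bar>G z\<bar> \<le> B0" by (auto simp: bounded_iff)
  then have B: "\<And>z. \<bar>G z\<bar> \<le> \<bar>B0\<bar> + 1" by (meson abs_ge_self add_increasing2 order_trans zero_le_one)
  define B where "B = \<bar>B0\<bar> + 1"
  have B: "\<And>z. \<bar>G z\<bar> \<le> B" "0 < B" using B by (auto simp: B_def)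
  \<comment> \<open>Removing tails of mass \<open>t\<close> in both variables costs \<open>2 * B * t = e / 4\<close>, and this is done for
    the sequence and for the limit.\<close>
  define t where "t = e / (8 * B)"
  have t: "0 < t" using e B by (simp add: t_def)
  obtain R where R: "(\<integral>x. 1 - cutoff R x \<partial>M) < t" using cutoff_tail[OF M t] by blast
  define c where "c = (cutoff R :: 'a \<Rightarrow> real)"
  have c: "continuous_on UNIV c" "\<And>x. 0 \<le> c x" "\<And>x. c x \<le> 1" "\<And>x. R + 1 \<le> norm x \<Longrightarrow> c x = 0"
    using cutoff_props unfolding c_def by blast+
  define H where "H z = c (fst z) * c (snd z) * G z" for z
  have Hc: "continuous_on UNIV H" unfolding H_def using G
    by (intro continuous_intros continuous_on_compose2[OF c(1)]) auto
  have c01: "0 \<le> c x * c y" "c x * c y \<le> 1" "1 - c x * c y \<le> (1 - c x) + (1 - c y)" for x y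
  proof -
    show "0 \<le> c x * c y" "c x * c y \<le> 1" using c by (auto intro: mult_le_one)
    have "0 \<le> (1 - c x) * (1 - c y)" using c by simp
    then show "1 - c x * c y \<le> (1 - c x) + (1 - c y)" by (simp add: algebra_simps)
  qed
  have Hb: "\<bar>H z\<bar> \<le> B" for z
    using mult_mono[OF c01(2)[of "fst z" "snd z"] B(1)[of z]] B(2) c(2) by (auto simp: H_def abs_mult)
  have lim: "(\<lambda>n. \<integral>z. H z \<partial>(P n \<Otimes>\<^sub>M P n)) \<longlonglongrightarrow> (\<integral>z. H z \<partial>(M \<Otimes>\<^sub>M M))"
  proof (rule narrow_pair_compact[OF narrow P M Hc Hb, where K="cball 0 (R + 1)"])
    show "H (x, y) = 0" if "x \<notin> cball 0 (R + 1) \<or> y \<notin> cball 0 (R + 1)" for x y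
      using that c(4)[of x] c(4)[of y] by (auto simp: H_def)
  qed auto
  have est: "\<bar>(\<integral>z. G z \<partial>(Q \<Otimes>\<^sub>M Q)) - (\<integral>z. H z \<partial>(Q \<Otimes>\<^sub>M Q))\<bar> \<le> e / 4"
    if Q: "Q \<in> prob_measures" "(\<integral>x. 1 - c x \<partial>Q) < t" for Q
  proof -
    interpret Q: prob_space Q using prob_measuresD Q by blast
    interpret QQ: pair_prob_space Q Q ..
    have i: "integrable (Q \<Otimes>\<^sub>M Q) G" "integrable (Q \<Otimes>\<^sub>M Q) H"
      using integrable_continuous_bounded[OF pair_prob_measures[OF Q(1) Q(1)]] G B Hc Hb by blast+
    have ic: "integrable Q (\<lambda>x. 1 - c x)"
      by (rule integrable_continuous_bounded[OF Q(1), of _ 1]) (use c in \<open>auto intro!: continuous_intros\<close>)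
    have id: "integrable (Q \<Otimes>\<^sub>M Q) (\<lambda>z. 1 - c (fst z))" "integrable (Q \<Otimes>\<^sub>M Q) (\<lambda>z. 1 - c (snd z))"
      by (rule integrable_continuous_bounded[OF pair_prob_measures[OF Q(1) Q(1)], of _ 1],
          use c in \<open>auto intro!: continuous_intros continuous_on_compose2[OF c(1)]\<close>)+
    have e1: "(\<integral>z. 1 - c (fst z) \<partial>(Q \<Otimes>\<^sub>M Q)) = (\<integral>x. 1 - c x \<partial>Q)"
      using QQ.integral_fst'[OF id(1)] Q.prob_space by simp
    have e2: "(\<integral>z. 1 - c (snd z) \<partial>(Q \<Otimes>\<^sub>M Q)) = (\<integral>x. 1 - c x \<partial>Q)"
      using QQ.integral_fst'[OF id(2)] Q.prob_space by simp
    have "\<bar>(\<integral>z. G z \<partial>(Q \<Otimes>\<^sub>M Q)) - (\<integral>z. H z \<partial>(Q \<Otimes>\<^sub>M Q))\<bar> = \<bar>\<integral>z. G z - H z \<partial>(Q \<Otimes>\<^sub>M Q)\<bar>"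
      using i by simp
    also have "\<dots> \<le> (\<integral>z. \<bar>G z - H z\<bar> \<partial>(Q \<Otimes>\<^sub>M Q))" by (rule integral_abs_bound)
    also have "\<dots> \<le> (\<integral>z. B * ((1 - c (fst z)) + (1 - c (snd z))) \<partial>(Q \<Otimes>\<^sub>M Q))"
    proof (intro integral_mono)
      fix z
      have "G z - H z = G z * (1 - c (fst z) * c (snd z))" by (simp add: H_def algebra_simps)
      then have "\<bar>G z - H z\<bar> = \<bar>G z\<bar> * (1 - c (fst z) * c (snd z))"
        using c01(2)[of "fst z" "snd z"] by (simp add: abs_mult)
      also have "\<dots> \<le> B * ((1 - c (fst z)) + (1 - c (snd z)))"
        using B c01 by (intro mult_mono) auto
      finally show "\<bar>G z - H z\<bar> \<le> B * ((1 - c (fst z)) + (1 - c (snd z)))" .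
    next
      show "integrable (Q \<Otimes>\<^sub>M Q) (\<lambda>z. B * ((1 - c (fst z)) + (1 - c (snd z))))"
        using id by (intro integrable_mult_right Bochner_Integration.integrable_add)
    qed (use i in auto)
    also have "\<dots> = B * ((\<integral>x. 1 - c x \<partial>Q) + (\<integral>x. 1 - c x \<partial>Q))"
      using e1 e2 Bochner_Integration.integral_add[OF id] by simp
    also have "\<dots> \<le> B * (t + t)" using Q(2) B(2) by (intro mult_left_mono) auto
    also have "\<dots> = e / 4" using B(2) by (simp add: t_def)
    finally show ?thesis .
  qed
  have "bounded (range (\<lambda>x. 1 - c x))" unfolding bounded_iff
    by (intro exI[of _ 1]) (use c in auto)
  moreover have "continuous_on UNIV (\<lambda>x. 1 - c x)" using c(1) by (intro continuous_intros)
  ultimately have "(\<lambda>n. \<integral>x. 1 - c x \<partial>P n) \<longlonglongrightarrow> (\<integral>x. 1 - c x \<partial>M)"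
    using narrow unfolding converges_narrowly_def by blast
  then have tail: "eventually (\<lambda>n. (\<integral>x. 1 - c x \<partial>P n) < t) sequentially"
    using R by (auto simp: c_def dest: order_tendstoD(2))
  have "eventually (\<lambda>n. dist (\<integral>z. H z \<partial>(P n \<Otimes>\<^sub>M P n)) (\<integral>z. H z \<partial>(M \<Otimes>\<^sub>M M)) < e / 4) sequentially"
    using lim e by (auto dest!: tendstoD[where e="e/4"])
  with tail show "eventually (\<lambda>n. dist (\<integral>z. G z \<partial>(P n \<Otimes>\<^sub>M P n)) (\<integral>z. G z \<partial>(M \<Otimes>\<^sub>M M)) < e) sequentially"
    using eventually_ge_at_top[of nmin]
  proof eventually_elim
    case (elim n)
    then show ?case
      using est[OF P, of n] est[OF M] R e unfolding dist_real_def c_def by linarith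
  qed
qed

section \<open>Lipschitz test functions determine a density\<close>

text \<open>
  The indicator of a closed set is the decreasing limit of the Lipschitz functions
  \<open>max 0 (1 - n * infdist x C)\<close>, and the closed sets form an intersection-stable generator of the
  Borel sets.
\<close>

lemma AE_zero_if_lipschitz_tests_vanish:
  fixes h :: "'a::euclidean_space \<Rightarrow> real"
  assumes M: "M \<in> prob_measures" and h: "integrable M h"
    and test: "\<And>\<psi> L. L-lipschitz_on UNIV \<psi> \<Longrightarrow> (\<And>x. \<bar>\<psi> x\<bar> \<le> 1) \<Longrightarrow> (\<integral>x. \<psi> x * h x \<partial>M) = 0"
  shows "AE x in M. h x = 0"
proof -
  interpret prob_space M using prob_measuresD M by blast
  note sM = prob_measuresD(2)[OF M]
  have closed: "(\<integral>x. indicator C x * h x \<partial>M) = 0" if C: "closed C" for C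
  proof (cases "C = {}")
    case False
    define \<psi> where "\<psi> n x = max 0 (1 - real n * infdist x C)" for n x
    have lip: "(real n)-lipschitz_on UNIV (\<psi> n)" for n
    proof (rule lipschitz_onI)
      fix x y :: 'a
      have "\<bar>infdist x C - infdist y C\<bar> \<le> dist x y" by (rule infdist_triangle_abs)
      then have "\<bar>real n * infdist x C - real n * infdist y C\<bar> \<le> real n * dist x y"
        by (simp add: abs_mult mult_left_mono flip: right_diff_distrib)
      then show "dist (\<psi> n x) (\<psi> n y) \<le> real n * dist x y"
        by (auto simp: \<psi>_def dist_real_def)
    qed auto
    have bd: "\<bar>\<psi> n x\<bar> \<le> 1" for n x
      using infdist_nonneg[of x C] by (auto simp: \<psi>_def)
    have psim: "\<psi> n \<in> borel_measurable M" for n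
      using borel_measurable_continuous_onI[OF lipschitz_on_continuous_on[OF lip]] sM
        measurable_cong_sets by blast
    have "(\<lambda>n. \<integral>x. \<psi> n x * h x \<partial>M) \<longlonglongrightarrow> (\<integral>x. indicator C x * h x \<partial>M)"
    proof (rule integral_dominated_convergence[where w="\<lambda>x. \<bar>h x\<bar>"])
      show "AE x in M. (\<lambda>n. \<psi> n x * h x) \<longlonglongrightarrow> indicator C x * h x"
      proof (rule AE_I2, rule tendsto_mult_right)
        fix x
        show "(\<lambda>n. \<psi> n x) \<longlonglongrightarrow> indicator C x"
        proof (cases "x \<in> C")
          case True then show ?thesis by (simp add: \<psi>_def)
        next
          case out: False
          then have "0 < infdist x C"
            using C False in_closed_iff_infdist_zero[of C x] infdist_nonneg[of x C] by force
          then obtain k :: nat where k: "1 < real k * infdist x C"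
            using reals_Archimedean3 by blast
          have "\<psi> n x = 0" if "k \<le> n" for n
          proof -
            have "real k * infdist x C \<le> real n * infdist x C"
              using that infdist_nonneg by (intro mult_right_mono) auto
            then show ?thesis using k by (simp add: \<psi>_def)
          qed
          then show ?thesis using out
            by (intro tendsto_eventually) (auto simp: eventually_at_top_linorder)
        qed
      qed
      show "AE x in M. norm (\<psi> n x * h x) \<le> \<bar>h x\<bar>" for n
        using bd[of n] by (intro AE_I2) (auto simp: abs_mult intro: mult_left_le_one_le)
    next
      have "C \<in> sets M" using C sM by auto
      then show "(\<lambda>x. indicator C x * h x) \<in> borel_measurable M"
        using integrable_mult_indicator[OF _ h, of C] by (auto dest: borel_measurable_integrable)
    qed (use h psim in auto)
    moreover have "(\<integral>x. \<psi> n x * h x \<partial>M) = 0" for n using test[OF lip bd] .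
    ultimately show ?thesis by (simp add: LIMSEQ_const_iff)
  qed simp
  have all: "(\<integral>x. indicator A x * h x \<partial>M) = 0" if "A \<in> sets borel" for A
  proof -
    have "Int_stable (Collect closed :: 'a set set)" "Collect closed \<subseteq> Pow (UNIV :: 'a set)"
      "A \<in> sigma_sets UNIV (Collect closed)"
      using that by (auto simp: borel_eq_closed Int_stable_def)
    then show ?thesis
    proof (induction rule: sigma_sets_induct_disjoint)
      case (compl A)
      then have A: "A \<in> sets M" using sM by (simp add: borel_eq_closed)
      have "(\<integral>x. indicator (UNIV - A) x * h x \<partial>M) = (\<integral>x. indicator UNIV x * h x - indicator A x * h x \<partial>M)"
        by (intro Bochner_Integration.integral_cong) (auto split: split_indicator)
      also have "\<dots> = (\<integral>x. indicator UNIV x * h x \<partial>M) - (\<integral>x. indicator A x * h x \<partial>M)"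
        using A h integrable_mult_indicator[OF A h]
        by (intro Bochner_Integration.integral_diff) auto
      finally show ?case using closed[of UNIV] compl.IH by simp
    next
      case (union A)
      then have A: "\<And>i. A i \<in> sets M" using sM by (auto simp: borel_eq_closed)
      have "(\<integral>x\<in>(\<Union>i. A i). h x \<partial>M) = (\<Sum>i. (\<integral>x\<in>(A i). h x \<partial>M))"
      proof (rule lebesgue_integral_countable_add)
        show "set_integrable M (\<Union>i. A i) h"
          unfolding set_integrable_def using A by (intro integrable_mult_indicator h) auto
      qed (use A union(1) in \<open>auto simp: disjoint_family_on_def\<close>)
      then show ?case using union.IH by (simp add: set_lebesgue_integral_def)
    qed (auto simp: closed)
  qed
  have "AE x in M. h x = 0"
    by (rule density_zero[OF h]) (use all sM in \<open>auto simp: set_lebesgue_integral_def\<close>)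
  then show ?thesis .
qed


section \<open>Singular integrals\<close>

text \<open>
  On the dyadic shell with outer radius \<open>(1/2)^k\<close> the integrand is at most
  \<open>2 powr (b * (k + 1))\<close>, and the surrounding ball has volume proportional to \<open>2 powr (- d * k)\<close>,
  so the integral is dominated by a geometric series with ratio \<open>2 powr (b - d) < 1\<close>.
\<close>

lemma nn_integral_ball_powr_finite:
  assumes b: "0 \<le> b" "b < real DIM('a::euclidean_space)"
  shows "(\<integral>\<^sup>+z\<in>ball (0::'a) 1. ennreal (norm z powr (- b)) \<partial>lborel) < \<infinity>"
proof -
  define d where "d = real DIM('a)"
  define c where "c = unit_ball_vol d * 2 powr b"
  have c0: "0 \<le> c" unfolding c_def by (simp add: d_def unit_ball_vol_nonneg)
  let ?g = "\<lambda>k z. ennreal (2 powr (b * (real k + 1))) * indicator (cball (0::'a) ((1 / 2) ^ k)) z"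
  have dom: "ennreal (norm z powr (- b)) * indicator (ball 0 1) z \<le> (\<Sum>k. ?g k z)" for z :: 'a
  proof (cases "z = 0 \<or> 1 \<le> norm z")
    case False
    then have z: "0 < norm z" "norm z < 1" by auto
    obtain n where n: "(1 / 2) ^ n < norm z" using real_arch_pow_inv[of "norm z" "1/2"] z by auto
    \<comment> \<open>\<open>k\<close> is the index of the dyadic shell containing \<open>z\<close>.\<close>
    define k where "k = (LEAST n. (1 / 2) ^ n < norm z) - 1"
    have L: "(1 / 2) ^ (LEAST n. (1 / 2) ^ n < norm z) < norm z" by (rule LeastI[of _ n]) (rule n)
    then have "(LEAST n. (1 / 2) ^ n < norm z) \<noteq> 0"
      using z by (metis not_less_iff_gr_or_eq power_0)
    then have k: "(LEAST n. (1 / 2) ^ n < norm z) = Suc k" by (simp add: k_def)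
    have lo: "(1 / 2) ^ Suc k < norm z" using L unfolding k .
    have hi: "norm z \<le> (1 / 2) ^ k" using not_less_Least[of k "\<lambda>n. (1 / 2) ^ n < norm z"] k by simp
    have "norm z powr (- b) \<le> ((1 / 2) ^ Suc k) powr (- b)"
      using lo b by (intro powr_mono2') auto
    also have "(1 / 2 :: real) ^ Suc k = 2 powr (- real (Suc k))"
      by (simp only: powr_minus powr_realpow zero_less_numeral power_one_over inverse_eq_divide)
    also have "\<dots> powr (- b) = 2 powr (b * (real k + 1))"
      by (simp add: powr_powr algebra_simps)
    finally have "ennreal (norm z powr (- b)) * indicator (ball 0 1) z \<le> ?g k z"
      using z hi by (simp add: ennreal_leI)
    also have "?g k z = (\<Sum>j\<in>{k}. ?g j z)"
      by (subst sum.insert) simp_all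
    also have "\<dots> \<le> (\<Sum>k. ?g k z)"
      by (rule sum_le_suminf[OF summableI]) simp_all
    finally show ?thesis .
  qed auto
  have int: "(\<integral>\<^sup>+z. ?g k z \<partial>lborel) = ennreal (c * (2 powr (b - d)) ^ k)" for k
  proof -
    have "(\<integral>\<^sup>+z. ?g k z \<partial>lborel) = ennreal (2 powr (b * (real k + 1))) * emeasure lborel (cball (0::'a) ((1 / 2) ^ k))"
      by (simp add: nn_integral_cmult_indicator)
    also have "\<dots> = ennreal (2 powr (b * (real k + 1)) * (unit_ball_vol d * ((1 / 2) ^ k) ^ DIM('a)))"
      by (subst emeasure_cball) (auto simp: d_def ennreal_mult')
    also have "2 powr (b * (real k + 1)) * (unit_ball_vol d * ((1 / 2) ^ k) ^ DIM('a)) = c * (2 powr (b - d)) ^ k"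
    proof -
      have "(1 / 2 :: real) ^ k = 2 powr (- real k)"
        by (simp only: powr_minus powr_realpow zero_less_numeral power_one_over inverse_eq_divide)
      moreover have "(2 powr (- real k)) ^ DIM('a) = 2 powr (- real k * d)"
        by (simp only: d_def powr_powr[symmetric] powr_realpow powr_gt_zero zero_less_numeral)
      moreover have "2 powr (b * (real k + 1)) * 2 powr (- real k * d) = 2 powr b * (2 powr (b - d)) ^ k"
      proof -
        have "2 powr b * (2 powr (b - d)) ^ k = 2 powr b * 2 powr ((b - d) * real k)"
          by (simp only: powr_powr[symmetric] powr_realpow powr_gt_zero zero_less_numeral)
        then show ?thesis by (simp add: algebra_simps flip: powr_add)
      qed
      ultimately show ?thesis by (simp add: c_def)
    qed
    finally show ?thesis .
  qed
  have r: "0 \<le> 2 powr (b - d)" "2 powr (b - d) < 1"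
    using b powr_less_mono[of "b - d" 0 2] by (auto simp: d_def)
  have "(\<integral>\<^sup>+z\<in>ball (0::'a) 1. ennreal (norm z powr (- b)) \<partial>lborel) \<le> (\<integral>\<^sup>+z. (\<Sum>k. ?g k z) \<partial>lborel)"
    by (intro nn_integral_mono dom)
  also have "\<dots> = (\<Sum>k. \<integral>\<^sup>+z. ?g k z \<partial>lborel)"
    by (intro nn_integral_suminf borel_measurable_times_ennreal borel_measurable_const
        borel_measurable_indicator) simp
  also have "\<dots> = (\<Sum>k. ennreal (c * (2 powr (b - d)) ^ k))" by (simp only: int)
  also have "\<dots> = ennreal (\<Sum>k. c * (2 powr (b - d)) ^ k)"
    using r c0 by (intro suminf_ennreal2 summable_mult summable_geometric) auto
  also have "\<dots> < \<infinity>" by simp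
  finally show ?thesis .
qed

text \<open>
  A form of Young's inequality without the optimal constants: if \<open>v powr (p - 1)\<close> is the larger one
  of \<open>u\<close> and \<open>v powr (p - 1)\<close>, the product is bounded by a power of \<open>v\<close> alone, and otherwise by a
  power of \<open>u\<close> alone.
\<close>

lemma mult_le_powr_sum:
  fixes u v p :: real
  assumes "0 \<le> u" "0 \<le> v" "1 < p"
  shows "u * v \<le> v powr p + u powr (p / (p - 1))"
proof (cases "u \<le> v powr (p - 1)")
  case True
  then have "u * v \<le> v powr (p - 1) * v powr 1" using assms by (intro mult_mono) auto
  also have "\<dots> = v powr p" by (simp only: powr_add[symmetric]) simp
  finally show ?thesis by (simp add: add_increasing2)
next
  case False
  then have "(v powr (p - 1)) powr (1 / (p - 1)) \<le> u powr (1 / (p - 1))"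
    using assms by (intro powr_mono2) auto
  then have "v \<le> u powr (1 / (p - 1))" using assms by (simp add: powr_powr)
  then have "u * v \<le> u powr 1 * u powr (1 / (p - 1))" using assms by (intro mult_mono) auto
  also have "\<dots> = u powr (1 + 1 / (p - 1))" by (simp only: powr_add)
  also have "1 + 1 / (p - 1) = p / (p - 1)" using assms by (simp add: field_simps)
  finally show ?thesis by (simp add: add_increasing)
qed

lemma nn_integral_lborel_reflect:
  fixes F :: "'a::euclidean_space \<Rightarrow> ennreal"
  assumes "F \<in> borel_measurable borel"
  shows "(\<integral>\<^sup>+y. F (x - y) \<partial>lborel) = (\<integral>\<^sup>+z. F z \<partial>lborel)"
proof -
  have "(\<integral>\<^sup>+z. F z \<partial>lborel) = (\<integral>\<^sup>+z. F z \<partial>density (distr lborel borel (\<lambda>y. x + (-1) *\<^sub>R y)) (\<lambda>_. ennreal (\<bar>-1\<bar> ^ DIM('a))))"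
    by (subst lborel_affine[of "-1" x]) auto
  also have "\<dots> = (\<integral>\<^sup>+y. F (x - y) \<partial>lborel)"
    using assms by (simp add: nn_integral_density nn_integral_distr)
  finally show ?thesis by simp
qed

text \<open>
  Away from the singularity the kernel is at most 1 and \<open>\<mu>\<close> has mass 1. Near it, the product
  \<open>m y * norm (x - y) powr (- b)\<close> is split into a function of \<open>y\<close> and a function of \<open>x - y\<close> whose
  integrals do not depend on \<open>x\<close>. For finite \<open>p\<close> the second one is the kernel to the conjugate power,
  and the condition on \<open>b\<close> says exactly that \<open>b * p / (p - 1)\<close> stays below the dimension.
\<close>

lemma riesz_potential_bounded:
  fixes m :: "'a::euclidean_space \<Rightarrow> real"
  assumes m: "m \<in> Lp_space p" "AE x in lborel. 0 \<le> m x"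
    and \<mu>: "\<mu> = density lborel (\<lambda>x. ennreal (m x))" "prob_space \<mu>"
    and b: "0 \<le> b" "p = \<infinity> \<and> b < real DIM('a) \<or> 1 < p \<and> p < \<infinity> \<and> b < real DIM('a) * (1 - 1 / real_of_ereal p)"
  obtains C where "0 \<le> C" "\<And>x. (\<integral>\<^sup>+y. ennreal (norm (x - y) powr (- b)) \<partial>\<mu>) \<le> ennreal C"
proof -
  interpret \<mu>: prob_space \<mu> by fact
  have mm[measurable]: "m \<in> borel_measurable borel" using m(1) by (auto simp: Lp_space_def)
  let ?B = "ball (0::'a) 1"
  obtain A h where A: "(\<integral>\<^sup>+y. ennreal (A y) \<partial>lborel) < \<infinity>" "A \<in> borel_measurable borel" "\<And>y. 0 \<le> A y"
    and h: "(\<integral>\<^sup>+z. ennreal (h z) * indicator ?B z \<partial>lborel) < \<infinity>" "h \<in> borel_measurable borel" "\<And>y. 0 \<le> h y"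
    and dom: "AE y in lborel. \<forall>x. m y * norm (x - y) powr (- b) \<le> A y + h (x - y)"
  proof (cases "p = \<infinity>")
    case True
    then obtain T where T: "AE x in lborel. \<bar>m x\<bar> \<le> T" using m(1) by (auto simp: Lp_space_def)
    let ?h = "\<lambda>z::'a. \<bar>T\<bar> * norm z powr (- b)"
    have [measurable]: "(\<lambda>z. ennreal (norm z powr (- b)) * indicator ?B z) \<in> borel_measurable borel"
      by (intro borel_measurable_times_ennreal borel_measurable_indicator) auto
    have "(\<integral>\<^sup>+z. ennreal (?h z) * indicator ?B z \<partial>lborel) = ennreal \<bar>T\<bar> * (\<integral>\<^sup>+z\<in>?B. ennreal (norm z powr (- b)) \<partial>lborel)"
      by (subst nn_integral_cmult[symmetric]) (auto simp: ennreal_mult' mult.assoc)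
    also have "\<dots> < \<infinity>"
      using nn_integral_ball_powr_finite[where 'a='a, of b] b True by (simp add: ennreal_mult_less_top)
    finally have "(\<integral>\<^sup>+z. ennreal (?h z) * indicator ?B z \<partial>lborel) < \<infinity>" .
    moreover have "AE y in lborel. \<forall>x. m y * norm (x - y) powr (- b) \<le> (0::real) + ?h (x - y)"
      using T by eventually_elim (auto intro!: mult_right_mono)
    ultimately show ?thesis by (intro that[of "\<lambda>_. 0" ?h]) auto
  next
    case False
    then obtain P where P: "p = ereal P" "1 < P" using b by (cases p) auto
    have bP: "b < real DIM('a) * (1 - 1 / P)" using b P by simp
    let ?A = "\<lambda>y. \<bar>m y\<bar> powr P" and ?h = "\<lambda>z::'a. norm z powr (- (b * (P / (P - 1))))"
    have "integrable lborel ?A" using m(1) P by (simp add: Lp_space_def)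
    then have A: "(\<integral>\<^sup>+y. ennreal (?A y) \<partial>lborel) < \<infinity>" by (simp add: integrable_iff_bounded)
    have "b * (P / (P - 1)) < real DIM('a) * (1 - 1 / P) * (P / (P - 1))"
      using P bP by (intro mult_strict_right_mono) auto
    also have "\<dots> = real DIM('a)" using P by (simp add: field_simps)
    finally have "(\<integral>\<^sup>+z\<in>?B. ennreal (?h z) \<partial>lborel) < \<infinity>"
      using P b by (intro nn_integral_ball_powr_finite) auto
    moreover have "AE y in lborel. \<forall>x. m y * norm (x - y) powr (- b) \<le> ?A y + ?h (x - y)"
      using m(2)
    proof eventually_elim
      case (elim y)
      show ?case
      proof
        fix x
        show "m y * norm (x - y) powr (- b) \<le> ?A y + ?h (x - y)"
          using mult_le_powr_sum[of "norm (x - y) powr (- b)" "m y" P] elim P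
          by (simp add: powr_powr mult.commute)
      qed
    qed
    ultimately show ?thesis using A by (intro that[of ?A ?h]) auto
  qed
  note [measurable] = A(2) h(2)
  have [measurable]: "(\<lambda>y. indicator ?B (x - y) :: ennreal) \<in> borel_measurable borel" for x
    by (rule measurable_compose[where N=borel, OF _ borel_measurable_indicator]) auto
  have [measurable]: "(indicator ?B :: 'a \<Rightarrow> ennreal) \<in> borel_measurable borel"
    by (rule borel_measurable_indicator) auto
  define C where "C = 1 + ((\<integral>\<^sup>+y. ennreal (A y) \<partial>lborel) + (\<integral>\<^sup>+z. ennreal (h z) * indicator ?B z \<partial>lborel))"
  have C: "C < \<infinity>" using A h by (simp add: C_def ennreal_add_eq_top less_top)
  have le: "(\<integral>\<^sup>+y. ennreal (norm (x - y) powr (- b)) \<partial>\<mu>) \<le> C" for x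
  proof -
    have "(\<integral>\<^sup>+y. ennreal (norm (x - y) powr (- b)) \<partial>\<mu>)
        \<le> (\<integral>\<^sup>+y. 1 + ennreal (norm (x - y) powr (- b)) * indicator ?B (x - y) \<partial>\<mu>)"
    proof (rule nn_integral_mono)
      fix y
      show "ennreal (norm (x - y) powr (- b)) \<le> 1 + ennreal (norm (x - y) powr (- b)) * indicator ?B (x - y)"
      proof (cases "norm (x - y) < 1")
        case False
        then have "norm (x - y) powr (- b) \<le> 1 powr (- b)" using b by (intro powr_mono2') auto
        then show ?thesis using False by simp
      qed (simp add: add_increasing)
    qed
    also have "\<dots> = 1 + (\<integral>\<^sup>+y. ennreal (norm (x - y) powr (- b)) * indicator ?B (x - y) \<partial>\<mu>)"
      unfolding \<mu>(1) using \<mu>.emeasure_space_1[unfolded \<mu>(1)] by (subst nn_integral_add) auto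
    also have "(\<integral>\<^sup>+y. ennreal (norm (x - y) powr (- b)) * indicator ?B (x - y) \<partial>\<mu>)
        = (\<integral>\<^sup>+y. ennreal (m y) * (ennreal (norm (x - y) powr (- b)) * indicator ?B (x - y)) \<partial>lborel)"
      unfolding \<mu>(1) by (subst nn_integral_density) auto
    also have "\<dots> \<le> (\<integral>\<^sup>+y. ennreal (A y) + ennreal (h (x - y)) * indicator ?B (x - y) \<partial>lborel)"
    proof (rule nn_integral_mono_AE)
      show "AE y in lborel. ennreal (m y) * (ennreal (norm (x - y) powr (- b)) * indicator ?B (x - y))
          \<le> ennreal (A y) + ennreal (h (x - y)) * indicator ?B (x - y)"
        using dom m(2)
      proof eventually_elim
        case (elim y)
        then have "ennreal (m y * norm (x - y) powr (- b)) \<le> ennreal (A y + h (x - y))" by (auto intro: ennreal_leI)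
        then show ?case using elim(2) A(3)[of y] h(3)[of "x - y"]
          by (auto simp: ennreal_mult' ennreal_plus split: split_indicator)
      qed
    qed
    also have "\<dots> = (\<integral>\<^sup>+y. ennreal (A y) \<partial>lborel) + (\<integral>\<^sup>+y. ennreal (h (x - y)) * indicator ?B (x - y) \<partial>lborel)"
      by (subst nn_integral_add) auto
    also have "(\<integral>\<^sup>+y. ennreal (h (x - y)) * indicator ?B (x - y) \<partial>lborel) = (\<integral>\<^sup>+z. ennreal (h z) * indicator ?B z \<partial>lborel)"
      by (rule nn_integral_lborel_reflect) measurable
    finally show ?thesis by (simp add: C_def add_left_mono)
  qed
  show ?thesis
  proof (rule that)
    show "0 \<le> enn2real C" by simp
    show "(\<integral>\<^sup>+y. ennreal (norm (x - y) powr (- b)) \<partial>\<mu>) \<le> ennreal (enn2real C)" for x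
      using le[of x] C by (simp add: less_top)
  qed
qed

section \<open>The kernel\<close>

lemma norm_grad_kernel:
  assumes "0 < q"
  shows "norm (grad_kernel q z) = (if z = 0 then 0 else q * norm z powr (q - 1))"
proof -
  have "norm z powr (q - 2) * norm z = norm z powr (q - 1)" if "z \<noteq> 0"
    using that powr_add[of "norm z" "q - 2" 1] by simp
  then show ?thesis using assms by (simp add: grad_kernel_def abs_mult)
qed

lemma grad_kernel_uminus: "grad_kernel q (- z) = - grad_kernel q z"
  by (simp add: grad_kernel_def)

lemma measurable_grad_kernel[measurable]: "grad_kernel q \<in> borel_measurable (borel :: 'a::euclidean_space measure)"
  unfolding grad_kernel_def[abs_def] by measurable

text \<open>
  The gradient of the kernel with the singular factor \<open>norm z powr (q - 2)\<close> kept constant inside the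
  ball of radius \<open>\<epsilon>\<close>. It is continuous, and it differs from the gradient only inside that ball,
  where the difference is no larger than the gradient itself.
\<close>

definition reg_kernel :: "real \<Rightarrow> real \<Rightarrow> 'a::euclidean_space \<Rightarrow> 'a" where
  "reg_kernel q \<epsilon> z = - (q * max \<epsilon> (norm z) powr (q - 2)) *\<^sub>R z"

lemma continuous_reg_kernel:
  assumes "0 < \<epsilon>"
  shows "continuous_on UNIV (reg_kernel q \<epsilon>)"
  unfolding reg_kernel_def[abs_def] using assms by (intro continuous_intros) auto

lemma norm_grad_kernel_diff_reg:
  assumes "0 < q" "q < 2" "0 < \<epsilon>"
  shows "norm (grad_kernel q z - reg_kernel q \<epsilon> z) \<le> (if norm z < \<epsilon> then norm (grad_kernel q z) else 0)"
proof (cases "z = 0 \<or> \<epsilon> \<le> norm z")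
  case True
  then show ?thesis using assms by (auto simp: grad_kernel_def reg_kernel_def max_def)
next
  case False
  then have z: "0 < norm z" "norm z < \<epsilon>" by auto
  have le: "\<epsilon> powr (q - 2) \<le> norm z powr (q - 2)" using z assms by (intro powr_mono2') auto
  have "grad_kernel q z - reg_kernel q \<epsilon> z = (q * (\<epsilon> powr (q - 2) - norm z powr (q - 2))) *\<^sub>R z"
    using z by (simp add: grad_kernel_def reg_kernel_def max_def algebra_simps scaleR_left_diff_distrib)
  then have "norm (grad_kernel q z - reg_kernel q \<epsilon> z) = q * (norm z powr (q - 2) - \<epsilon> powr (q - 2)) * norm z"
    using assms le by (simp add: abs_mult)
  also have "\<dots> \<le> q * norm z powr (q - 2) * norm z"
    using assms z by (intro mult_right_mono mult_left_mono) auto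
  also have "\<dots> = norm (grad_kernel q z)" using z assms by (simp add: grad_kernel_def abs_mult)
  finally show ?thesis using z by simp
qed

text \<open>
  A single bound for the whole range of \<open>q\<close>: the weight controls the growth at infinity, which occurs
  for \<open>q > 1\<close>, and the negative power controls the singularity at the origin, which occurs for
  \<open>q < 1\<close>.
\<close>

lemma norm_grad_kernel_le:
  assumes q: "0 < q" and b: "1 - q \<le> b"
  shows "norm (grad_kernel q z) \<le> q * ((1 + norm z) powr max 0 (q - 1) + norm z powr (- b))"
proof (cases "z = 0")
  case False
  have "norm z powr (q - 1) \<le> (1 + norm z) powr max 0 (q - 1) + norm z powr (- b)"
  proof (cases "1 \<le> q")
    case True
    then have "norm z powr (q - 1) \<le> (1 + norm z) powr (q - 1)" by (intro powr_mono2) auto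
    then show ?thesis using True by (simp add: max_def add_increasing2)
  next
    case q1: False
    show ?thesis
    proof (cases "1 \<le> norm z")
      case True
      then have "norm z powr (q - 1) \<le> norm z powr 0" using q1 by (intro powr_mono) auto
      moreover have ne: "1 + norm z \<noteq> 0" using norm_ge_zero[of z] by linarith
      moreover have "(1 + norm z) powr max 0 (q - 1) = 1" using q1 ne by simp
      moreover have "norm z powr 0 = 1" using False by simp
      ultimately show ?thesis using powr_ge_zero[of "norm z" "-b"] by linarith
    next
      case z1: False
      have "norm z powr (q - 1) \<le> norm z powr (- b)" using False z1 b by (intro powr_mono') auto
      then show ?thesis by (rule add_increasing[OF powr_ge_zero])
    qed
  qed
  then show ?thesis using q False by (simp add: norm_grad_kernel)
qed (use q in \<open>simp add: grad_kernel_def\<close>)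

text \<open>
  This is why growth is measured by powers of \<open>1 + norm x\<close>: a bound in terms of the difference of two
  points separates into factors depending on one point each, so that moments of the two marginals
  control integrals over pairs.
\<close>

lemma weight_submultiplicative:
  fixes x y :: "'a::real_normed_vector"
  assumes "0 \<le> a"
  shows "(1 + norm (x - y)) powr a \<le> (1 + norm x) powr a * (1 + norm y) powr a"
proof -
  have "(1 + norm x) * (1 + norm y) = 1 + norm x + norm y + norm x * norm y"
    by (simp add: algebra_simps)
  moreover have "0 \<le> norm x * norm y" by simp
  ultimately have "1 + norm (x - y) \<le> (1 + norm x) * (1 + norm y)"
    using norm_triangle_ineq4[of x y] by linarith
  then show ?thesis using assms by (simp add: powr_mono2 flip: powr_mult)
qed


lemma reg_kernel_bound:
  fixes q \<epsilon> :: real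
  assumes q: "0 < q" "q < 2" and e: "0 < \<epsilon>"
  obtains K where "0 \<le> K" "\<And>z :: 'a::euclidean_space. norm (reg_kernel q \<epsilon> z) \<le> K * (1 + norm z) powr max 0 (q - 1)"
proof -
  define K where "K = q * (1 + \<epsilon> powr (- 1) + \<epsilon> powr (q - 1))"
  have "norm (reg_kernel q \<epsilon> z) \<le> K * (1 + norm z) powr max 0 (q - 1)" for z :: 'a
  proof -
    have w: "1 \<le> (1 + norm z) powr max 0 (q - 1)" by (rule ge_one_powr_ge_zero) auto
    have "norm (reg_kernel q \<epsilon> z) \<le> q * ((1 + norm z) powr max 0 (q - 1) + (\<epsilon> powr (- 1) + \<epsilon> powr (q - 1)))"
    proof (cases "norm z < \<epsilon>")
      case True
      then have "norm (reg_kernel q \<epsilon> z) = q * (\<epsilon> powr (q - 2) * norm z)"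
        using q by (simp add: reg_kernel_def max_def abs_mult)
      also have "\<dots> \<le> q * (\<epsilon> powr (q - 2) * \<epsilon> powr 1)"
        using True q e by (intro mult_left_mono) auto
      also have "\<dots> = q * \<epsilon> powr (q - 1)" by (simp only: powr_add[symmetric]) simp
      also have "\<dots> \<le> q * ((1 + norm z) powr max 0 (q - 1) + (\<epsilon> powr (- 1) + \<epsilon> powr (q - 1)))"
        using q by (intro mult_left_mono) auto
      finally show ?thesis .
    next
      case False
      then have z: "z \<noteq> 0" "\<epsilon> \<le> norm z" using e by auto
      then have eq: "reg_kernel q \<epsilon> z = grad_kernel q z" by (simp add: reg_kernel_def grad_kernel_def)
      have "norm (grad_kernel q z) \<le> q * ((1 + norm z) powr max 0 (q - 1) + norm z powr (- 1))"
        using q by (intro norm_grad_kernel_le) auto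
      moreover have "norm z powr (- 1) \<le> \<epsilon> powr (- 1)" using z e by (intro powr_mono2') auto
      then have "q * ((1 + norm z) powr max 0 (q - 1) + norm z powr (- 1))
          \<le> q * ((1 + norm z) powr max 0 (q - 1) + (\<epsilon> powr (- 1) + \<epsilon> powr (q - 1)))"
        using q by (intro mult_left_mono add_mono order_refl) (auto intro: add_increasing2)
      ultimately show ?thesis unfolding eq by (rule order_trans)
    qed
    also have "\<dots> \<le> K * (1 + norm z) powr max 0 (q - 1)"
    proof -
      have "\<epsilon> powr (- 1) + \<epsilon> powr (q - 1) \<le> (\<epsilon> powr (- 1) + \<epsilon> powr (q - 1)) * (1 + norm z) powr max 0 (q - 1)"
        using mult_left_mono[OF w, of "\<epsilon> powr (- 1) + \<epsilon> powr (q - 1)"] by simp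
      then have "q * ((1 + norm z) powr max 0 (q - 1) + (\<epsilon> powr (- 1) + \<epsilon> powr (q - 1)))
        \<le> q * ((1 + norm z) powr max 0 (q - 1) + (\<epsilon> powr (- 1) + \<epsilon> powr (q - 1)) * (1 + norm z) powr max 0 (q - 1))"
        using q by (intro mult_left_mono add_mono order_refl) auto
      then show ?thesis by (simp add: K_def algebra_simps)
    qed
    finally show ?thesis .
  qed
  then show ?thesis using that[of K] q by (simp add: K_def)
qed

section \<open>The force exerted by the target\<close>

text \<open>
  The properties of the target that the limit passage uses. The exponent \<open>b\<close> is strictly larger than
  the order \<open>1 - q\<close> of the singularity, and this margin gives a rate of convergence when the kernel
  is regularised.
\<close>

locale singular_target =
  fixes q b C :: real and \<mu> :: "'a::euclidean_space measure"
  assumes q: "0 < q" "q < 2" and b: "1 - q < b" and \<mu>: "\<mu> \<in> prob_measures"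
    and moment: "integrable \<mu> (\<lambda>y. (1 + norm y) powr max 0 (q - 1))"
    and riesz: "\<And>x. (\<integral>\<^sup>+y. ennreal (norm (x - y) powr (- b)) \<partial>\<mu>) \<le> ennreal C" and C: "0 \<le> C"
begin

sublocale prob_space \<mu> using prob_measuresD \<mu> by blast

lemma sets_mu[measurable_cong]: "sets \<mu> = sets borel" by (rule prob_measuresD(2)[OF \<mu>])

lemma riesz_integral:
  "integrable \<mu> (\<lambda>y. norm (x - y) powr (- b))" "(\<integral>y. norm (x - y) powr (- b) \<partial>\<mu>) \<le> C"
proof -
  show i: "integrable \<mu> (\<lambda>y. norm (x - y) powr (- b))"
    using riesz[of x] by (intro integrableI_bounded) (auto simp: le_less_trans)
  show "(\<integral>y. norm (x - y) powr (- b) \<partial>\<mu>) \<le> C"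
    using riesz[of x] C i by (subst integral_eq_nn_integral) (auto intro: enn2real_leI)
qed

lemma grad_kernel_pointwise:
  "norm (grad_kernel q (x - y)) \<le> q * ((1 + norm x) powr max 0 (q - 1) * (1 + norm y) powr max 0 (q - 1) + norm (x - y) powr (- b))"
proof -
  have "norm (grad_kernel q (x - y)) \<le> q * ((1 + norm (x - y)) powr max 0 (q - 1) + norm (x - y) powr (- b))"
    using q b by (intro norm_grad_kernel_le) auto
  also have "\<dots> \<le> q * ((1 + norm x) powr max 0 (q - 1) * (1 + norm y) powr max 0 (q - 1) + norm (x - y) powr (- b))"
    using q by (intro mult_left_mono add_mono weight_submultiplicative) auto
  finally show ?thesis .
qed

lemma grad_kernel_integrable: "integrable \<mu> (\<lambda>y. grad_kernel q (x - y))"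
proof (rule Bochner_Integration.integrable_bound)
  show "integrable \<mu> (\<lambda>y. q * ((1 + norm x) powr max 0 (q - 1) * (1 + norm y) powr max 0 (q - 1) + norm (x - y) powr (- b)))"
    using moment riesz_integral by (intro integrable_mult_right Bochner_Integration.integrable_add) auto
  show "AE y in \<mu>. norm (grad_kernel q (x - y)) \<le> norm (q * ((1 + norm x) powr max 0 (q - 1) * (1 + norm y) powr max 0 (q - 1) + norm (x - y) powr (- b)))"
    using grad_kernel_pointwise by (intro AE_I2) (auto intro: order_trans[OF _ abs_ge_self])
qed measurable

definition target_force :: "'a \<Rightarrow> 'a" where "target_force x = (\<integral>y. grad_kernel q (x - y) \<partial>\<mu>)"

lemma target_force_growth:
  obtains K where "0 \<le> K" "\<And>x. norm (target_force x) \<le> K * (1 + norm x) powr max 0 (q - 1)"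
proof -
  define M where "M = (\<integral>y. (1 + norm y) powr max 0 (q - 1) \<partial>\<mu>)"
  have M: "0 \<le> M" unfolding M_def by (intro Bochner_Integration.integral_nonneg) auto
  have "norm (target_force x) \<le> (q * (M + C)) * (1 + norm x) powr max 0 (q - 1)" for x
  proof -
    let ?w = "(1 + norm x) powr max 0 (q - 1)"
    have w: "1 \<le> ?w" by (rule ge_one_powr_ge_zero) auto
    have "norm (target_force x) \<le> (\<integral>y. norm (grad_kernel q (x - y)) \<partial>\<mu>)" unfolding target_force_def by (rule integral_norm_bound)
    also have "\<dots> \<le> (\<integral>y. q * (?w * (1 + norm y) powr max 0 (q - 1) + norm (x - y) powr (- b)) \<partial>\<mu>)"
      using grad_kernel_integrable moment riesz_integral grad_kernel_pointwise
      by (intro integral_mono integrable_mult_right Bochner_Integration.integrable_add) auto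
    also have "\<dots> = q * (?w * M + (\<integral>y. norm (x - y) powr (- b) \<partial>\<mu>))"
      using moment riesz_integral by (simp add: M_def)
    also have "\<dots> \<le> q * (?w * M + C * ?w)"
      using q riesz_integral(2)[of x] mult_left_mono[OF w C] by (intro mult_left_mono add_mono) auto
    finally show ?thesis by (simp add: algebra_simps)
  qed
  then show ?thesis using that[of "q * (M + C)"] M C q by simp
qed

text \<open>
  Regularising the kernel at scale \<open>\<epsilon>\<close> changes the force by at most a multiple of
  \<open>\<epsilon> powr (q - 1 + b)\<close>, uniformly in \<open>x\<close>: inside the ball of radius \<open>\<epsilon>\<close> the difference is bounded by
  \<open>norm z powr (q - 1) = norm z powr (q - 1 + b) * norm z powr (- b)\<close>. The regularised forces are
  continuous by dominated convergence.
\<close>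

lemma target_force_continuous: "continuous_on UNIV target_force"
proof -
  define reg_force where "reg_force \<epsilon> x = (\<integral>y. reg_kernel q \<epsilon> (x - y) \<partial>\<mu>)" for \<epsilon> x
  have rm: "reg_kernel q \<epsilon> \<in> borel_measurable borel" if "0 < \<epsilon>" for \<epsilon>
    using continuous_reg_kernel[OF that] by (rule borel_measurable_continuous_onI)
  have ri: "integrable \<mu> (\<lambda>y. reg_kernel q \<epsilon> (x - y))" if e: "0 < \<epsilon>" for \<epsilon> x
  proof -
    note [measurable] = rm[OF e]
    have "integrable \<mu> (\<lambda>y. grad_kernel q (x - y) - reg_kernel q \<epsilon> (x - y))"
    proof (rule Bochner_Integration.integrable_bound[OF grad_kernel_integrable[of x]])
      show "AE y in \<mu>. norm (grad_kernel q (x - y) - reg_kernel q \<epsilon> (x - y)) \<le> norm (grad_kernel q (x - y))"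
      proof (rule AE_I2)
        fix y show "norm (grad_kernel q (x - y) - reg_kernel q \<epsilon> (x - y)) \<le> norm (grad_kernel q (x - y))"
          using norm_grad_kernel_diff_reg[OF q e, of "x - y"] by (auto split: if_splits)
      qed
    qed measurable
    from Bochner_Integration.integrable_diff[OF grad_kernel_integrable[of x] this] show ?thesis by simp
  qed
  have diff: "norm (target_force x - reg_force \<epsilon> x) \<le> q * \<epsilon> powr (q - 1 + b) * C" if e: "0 < \<epsilon>" for \<epsilon> x
  proof -
    have pw: "norm (grad_kernel q z - reg_kernel q \<epsilon> z) \<le> q * \<epsilon> powr (q - 1 + b) * norm z powr (- b)" for z :: 'a
    proof (cases "z = 0 \<or> \<epsilon> \<le> norm z")
      case True
      then show ?thesis using norm_grad_kernel_diff_reg[OF q e, of z] q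
        by (auto simp: grad_kernel_def split: if_splits)
    next
      case False
      then have "norm (grad_kernel q z - reg_kernel q \<epsilon> z) \<le> q * norm z powr (q - 1)"
        using norm_grad_kernel_diff_reg[OF q e, of z] q by (auto simp: norm_grad_kernel)
      also have "norm z powr (q - 1) = norm z powr (q - 1 + b) * norm z powr (- b)"
        by (simp flip: powr_add)
      also have "q * \<dots> \<le> q * (\<epsilon> powr (q - 1 + b) * norm z powr (- b))"
        using False b q by (intro mult_left_mono mult_right_mono powr_mono2) auto
      finally show ?thesis by (simp add: mult.assoc)
    qed
    have "target_force x - reg_force \<epsilon> x = (\<integral>y. grad_kernel q (x - y) - reg_kernel q \<epsilon> (x - y) \<partial>\<mu>)"
      unfolding target_force_def reg_force_def using grad_kernel_integrable ri[OF e]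
      by (rule Bochner_Integration.integral_diff[symmetric])
    then have "norm (target_force x - reg_force \<epsilon> x) \<le> (\<integral>y. norm (grad_kernel q (x - y) - reg_kernel q \<epsilon> (x - y)) \<partial>\<mu>)"
      by (simp add: integral_norm_bound)
    also have "\<dots> \<le> (\<integral>y. q * \<epsilon> powr (q - 1 + b) * norm (x - y) powr (- b) \<partial>\<mu>)"
      using grad_kernel_integrable ri[OF e] riesz_integral pw by (intro integral_mono) auto
    also have "\<dots> \<le> q * \<epsilon> powr (q - 1 + b) * C"
      using riesz_integral(2)[of x] q by (simp add: mult_left_mono)
    finally show ?thesis .
  qed
  have reg_force_continuous: "continuous_on UNIV (reg_force \<epsilon>)" if e: "0 < \<epsilon>" for \<epsilon>
  proof (rule continuous_at_imp_continuous_on, rule ballI, rule continuous_at_sequentiallyI)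
    fix x and u :: "nat \<Rightarrow> 'a" assume u: "u \<longlonglongrightarrow> x"
    obtain K where K: "0 \<le> K" "\<And>z :: 'a. norm (reg_kernel q \<epsilon> z) \<le> K * (1 + norm z) powr max 0 (q - 1)"
      using reg_kernel_bound[OF q e] by blast
    obtain B where B: "\<And>n. norm (u n) \<le> B"
      using convergent_imp_Bseq[OF convergentI[OF u]] by (auto simp: Bseq_def)
    show "(\<lambda>n. reg_force \<epsilon> (u n)) \<longlonglongrightarrow> reg_force \<epsilon> x"
      unfolding reg_force_def
    proof (rule integral_dominated_convergence[where w="\<lambda>y. K * ((1 + B) powr max 0 (q - 1) * (1 + norm y) powr max 0 (q - 1))"])
      show "AE y in \<mu>. (\<lambda>n. reg_kernel q \<epsilon> (u n - y)) \<longlonglongrightarrow> reg_kernel q \<epsilon> (x - y)"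
        by (intro AE_I2 continuous_on_tendsto_compose[OF continuous_reg_kernel[OF e]] tendsto_intros u) auto
      show "AE y in \<mu>. norm (reg_kernel q \<epsilon> (u n - y)) \<le> K * ((1 + B) powr max 0 (q - 1) * (1 + norm y) powr max 0 (q - 1))" for n
      proof (rule AE_I2)
        fix y
        have "norm (reg_kernel q \<epsilon> (u n - y)) \<le> K * (1 + norm (u n - y)) powr max 0 (q - 1)" by (rule K)
        also have "\<dots> \<le> K * ((1 + norm (u n)) powr max 0 (q - 1) * (1 + norm y) powr max 0 (q - 1))"
          using K(1) by (intro mult_left_mono weight_submultiplicative) auto
        also have "\<dots> \<le> K * ((1 + B) powr max 0 (q - 1) * (1 + norm y) powr max 0 (q - 1))"
          using K(1) B by (intro mult_left_mono mult_right_mono powr_mono2) auto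
        finally show "norm (reg_kernel q \<epsilon> (u n - y)) \<le> K * ((1 + B) powr max 0 (q - 1) * (1 + norm y) powr max 0 (q - 1))" .
      qed
    next
      show "integrable \<mu> (\<lambda>y. K * ((1 + B) powr max 0 (q - 1) * (1 + norm y) powr max 0 (q - 1)))"
        using moment by (intro integrable_mult_right)
    qed (use ri[OF e] in \<open>auto dest: borel_measurable_integrable\<close>)
  qed
  show ?thesis
  proof (rule uniform_limit_theorem)
    show "\<forall>\<^sub>F n in sequentially. continuous_on UNIV (reg_force (1 / real (Suc n)))"
      by (intro always_eventually allI reg_force_continuous) simp
    show "uniform_limit UNIV (\<lambda>n. reg_force (1 / real (Suc n))) target_force sequentially"
    proof (rule uniform_limitI)
      fix e :: real assume e: "0 < e"
      have "(\<lambda>n. q * (1 / real (Suc n)) powr (q - 1 + b) * C) \<longlonglongrightarrow> q * 0 * C"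
        by (intro tendsto_intros tendsto_zero_powrI[where b="q - 1 + b"] LIMSEQ_Suc[OF lim_1_over_n])
           (use b in auto)
      then have "\<forall>\<^sub>F n in sequentially. q * (1 / real (Suc n)) powr (q - 1 + b) * C < e"
        using e by (intro order_tendstoD) auto
      then show "\<forall>\<^sub>F n in sequentially. \<forall>x\<in>UNIV. dist (reg_force (1 / real (Suc n)) x) (target_force x) < e"
      proof eventually_elim
        case (elim n)
        show ?case
        proof
          fix x
          have "dist (reg_force (1 / real (Suc n)) x) (target_force x) \<le> q * (1 / real (Suc n)) powr (q - 1 + b) * C"
            using diff[of "1 / real (Suc n)" x] by (simp add: dist_norm norm_minus_commute)
          then show "dist (reg_force (1 / real (Suc n)) x) (target_force x) < e" using elim by linarith
        qed
      qed
    qed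
  qed simp
qed

end

section \<open>The symmetrised interaction\<close>

text \<open>
  Twice the part of \<open>\<psi> x * (grad_kernel q (x - y) \<bullet> e)\<close> that is symmetric under exchanging the two
  points. The other part is antisymmetric and cancels in every integral over a product of a measure
  with itself.
\<close>

definition interaction :: "real \<Rightarrow> ('a::euclidean_space \<Rightarrow> real) \<Rightarrow> 'a \<Rightarrow> 'a \<times> 'a \<Rightarrow> real" where
  "interaction q \<psi> e z = (\<psi> (fst z) - \<psi> (snd z)) * (grad_kernel q (fst z - snd z) \<bullet> e)"

text \<open>
  The difference of the test function is used in two ways: bounded by 2 against the growth of the
  kernel at infinity, and by \<open>L * norm (x - y)\<close> against its singularity, which is at most of order 1.
\<close>

lemma interaction_growth:
  fixes \<psi> :: "'a::euclidean_space \<Rightarrow> real"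
  assumes q: "0 < q" and \<psi>: "L-lipschitz_on UNIV \<psi>" "\<And>x. \<bar>\<psi> x\<bar> \<le> 1" and e: "norm e \<le> 1"
  shows "\<bar>interaction q \<psi> e z\<bar> \<le> q * (2 + L) * ((1 + norm (fst z)) powr max 0 (q - 1) * (1 + norm (snd z)) powr max 0 (q - 1))"
proof -
  obtain x y where z: "z = (x, y)" by (cases z)
  let ?a = "max 0 (q - 1)"
  let ?u = "x - y"
  have L: "0 \<le> L" using lipschitz_on_nonneg \<psi>(1) .
  have d1: "\<bar>\<psi> x - \<psi> y\<bar> \<le> 2" using \<psi>(2)[of x] \<psi>(2)[of y] by linarith
  have d2: "\<bar>\<psi> x - \<psi> y\<bar> \<le> L * norm ?u"
    using lipschitz_onD[OF \<psi>(1), of x y] by (simp add: dist_norm)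
  have w: "1 \<le> (1 + norm ?u) powr ?a" by (rule ge_one_powr_ge_zero) auto
  have "\<bar>interaction q \<psi> e z\<bar> \<le> \<bar>\<psi> x - \<psi> y\<bar> * norm (grad_kernel q ?u)"
    using Cauchy_Schwarz_ineq2[of "grad_kernel q ?u" e] mult_left_mono[OF e norm_ge_zero[of "grad_kernel q ?u"]]
    by (simp add: z interaction_def abs_mult mult_left_mono)
  also have "\<dots> \<le> \<bar>\<psi> x - \<psi> y\<bar> * (q * ((1 + norm ?u) powr ?a + norm ?u powr (- 1)))"
    using q by (intro mult_left_mono norm_grad_kernel_le) auto
  also have "\<dots> = q * (\<bar>\<psi> x - \<psi> y\<bar> * (1 + norm ?u) powr ?a + \<bar>\<psi> x - \<psi> y\<bar> * norm ?u powr (- 1))"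
    by (simp add: algebra_simps)
  also have "\<dots> \<le> q * (2 * (1 + norm ?u) powr ?a + L * (1 + norm ?u) powr ?a)"
  proof (intro mult_left_mono add_mono)
    have "\<bar>\<psi> x - \<psi> y\<bar> * norm ?u powr (- 1) \<le> L * norm ?u * norm ?u powr (- 1)"
      using d2 by (intro mult_right_mono) auto
    also have "\<dots> \<le> L * 1" using L by (cases "?u = 0") (auto simp: powr_minus mult.assoc)
    also have "\<dots> \<le> L * (1 + norm ?u) powr ?a" using L w by (intro mult_left_mono)
    finally show "\<bar>\<psi> x - \<psi> y\<bar> * norm ?u powr (- 1) \<le> L * (1 + norm ?u) powr ?a" .
  qed (use d1 q in \<open>auto intro: mult_right_mono\<close>)
  also have "\<dots> = q * (2 + L) * (1 + norm ?u) powr ?a" by (simp add: algebra_simps)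
  also have "\<dots> \<le> q * (2 + L) * ((1 + norm x) powr ?a * (1 + norm y) powr ?a)"
    using q L by (intro mult_left_mono weight_submultiplicative) auto
  finally show ?thesis by (simp add: z)
qed

text \<open>
  Replacing the kernel by its regularisation costs at most \<open>L * norm z\<close> times \<open>q * norm z powr (q - 1)\<close>
  inside the ball of radius \<open>\<epsilon>\<close>. This is of order \<open>\<epsilon> powr q\<close>, so \<open>q > 0\<close> is what makes the
  interaction a uniform limit of continuous functions.
\<close>

lemma interaction_continuous:
  fixes \<psi> :: "'a::euclidean_space \<Rightarrow> real"
  assumes q: "0 < q" "q < 2" and \<psi>: "L-lipschitz_on UNIV \<psi>" and e: "norm e \<le> 1"
  shows "continuous_on UNIV (interaction q \<psi> e)"
proof -
  define I where "I \<epsilon> z = (\<psi> (fst z) - \<psi> (snd z)) * (reg_kernel q \<epsilon> (fst z - snd z) \<bullet> e)" for \<epsilon> z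
  have L: "0 \<le> L" using lipschitz_on_nonneg \<psi>(1) .
  have c: "continuous_on UNIV \<psi>" using lipschitz_on_continuous_on[OF \<psi>] .
  have Ic: "continuous_on UNIV (I \<epsilon>)" if "0 < \<epsilon>" for \<epsilon>
    unfolding I_def
    by (intro continuous_intros continuous_on_compose2[OF c] continuous_on_compose2[OF continuous_reg_kernel[OF that]]) auto
  have diff: "\<bar>interaction q \<psi> e z - I \<epsilon> z\<bar> \<le> L * (q * \<epsilon> powr q)" if ep: "0 < \<epsilon>" for \<epsilon> z
  proof -
    obtain x y where z: "z = (x, y)" by (cases z)
    let ?u = "x - y"
    have "\<bar>interaction q \<psi> e z - I \<epsilon> z\<bar> = \<bar>\<psi> x - \<psi> y\<bar> * \<bar>(grad_kernel q ?u - reg_kernel q \<epsilon> ?u) \<bullet> e\<bar>"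
      by (simp add: z interaction_def I_def abs_mult[symmetric] inner_diff_left algebra_simps)
    also have "\<dots> \<le> (L * norm ?u) * (if norm ?u < \<epsilon> then norm (grad_kernel q ?u) else 0)"
    proof (rule mult_mono)
      show "\<bar>\<psi> x - \<psi> y\<bar> \<le> L * norm ?u"
        using lipschitz_onD[OF \<psi>(1), of x y] by (simp add: dist_norm)
      have "\<bar>(grad_kernel q ?u - reg_kernel q \<epsilon> ?u) \<bullet> e\<bar> \<le> norm (grad_kernel q ?u - reg_kernel q \<epsilon> ?u) * norm e"
        by (rule Cauchy_Schwarz_ineq2)
      also have "\<dots> \<le> norm (grad_kernel q ?u - reg_kernel q \<epsilon> ?u)" using e by (simp add: mult_left_le)
      also have "\<dots> \<le> (if norm ?u < \<epsilon> then norm (grad_kernel q ?u) else 0)"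
        by (rule norm_grad_kernel_diff_reg[OF q ep])
      finally show "\<bar>(grad_kernel q ?u - reg_kernel q \<epsilon> ?u) \<bullet> e\<bar> \<le> (if norm ?u < \<epsilon> then norm (grad_kernel q ?u) else 0)" .
    qed (use L in auto)
    also have "\<dots> \<le> L * (q * \<epsilon> powr q)"
    proof (cases "?u = 0 \<or> \<epsilon> \<le> norm ?u")
      case True
      then show ?thesis using L q by auto
    next
      case False
      have "norm ?u powr 1 * norm ?u powr (q - 1) = norm ?u powr q" by (simp only: powr_add[symmetric]) simp
      then have "(L * norm ?u) * norm (grad_kernel q ?u) = L * (q * norm ?u powr q)"
        using False q by (simp add: norm_grad_kernel)
      also have "\<dots> \<le> L * (q * \<epsilon> powr q)"
        using False q L by (intro mult_left_mono powr_mono2) auto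
      finally show ?thesis using False by simp
    qed
    finally show ?thesis .
  qed
  show ?thesis
  proof (rule uniform_limit_theorem)
    show "\<forall>\<^sub>F n in sequentially. continuous_on UNIV (I (1 / real (Suc n)))"
      by (intro always_eventually allI Ic) simp
    show "uniform_limit UNIV (\<lambda>n. I (1 / real (Suc n))) (interaction q \<psi> e) sequentially"
    proof (rule uniform_limitI)
      fix d :: real assume d: "0 < d"
      have "(\<lambda>n. L * (q * (1 / real (Suc n)) powr q)) \<longlonglongrightarrow> L * (q * 0)"
        by (intro tendsto_intros tendsto_zero_powrI[where b=q] LIMSEQ_Suc[OF lim_1_over_n])
           (use q in auto)
      then have "\<forall>\<^sub>F n in sequentially. L * (q * (1 / real (Suc n)) powr q) < d"
        using d by (intro order_tendstoD) auto
      then show "\<forall>\<^sub>F n in sequentially. \<forall>x\<in>UNIV. dist (I (1 / real (Suc n)) x) (interaction q \<psi> e x) < d"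
      proof eventually_elim
        case (elim n)
        show ?case
        proof
          fix x
          have "dist (I (1 / real (Suc n)) x) (interaction q \<psi> e x) \<le> L * (q * (1 / real (Suc n)) powr q)"
            using diff[of "1 / real (Suc n)" x] by (simp add: dist_real_def abs_minus_commute)
          then show "dist (I (1 / real (Suc n)) x) (interaction q \<psi> e x) < d" using elim by linarith
        qed
      qed
    qed
  qed simp
qed


section \<open>Empirical measures\<close>

lemma empirical_prob_measures:
  assumes "1 \<le> N"
  shows "empirical N x \<in> prob_measures"
proof -
  interpret prob_space "uniform_count_measure {1..N}"
    using assms by (intro prob_space_uniform_count_measure) auto
  have m: "x \<in> measurable (uniform_count_measure {1..N}) borel"
    by (simp add: measurable_def space_uniform_count_measure sets_uniform_count_measure)
  show ?thesis
    unfolding empirical_def prob_measures_def using prob_space_distr[OF m] by simp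
qed

lemma integrable_empirical:
  fixes \<phi> :: "'a::euclidean_space \<Rightarrow> real"
  assumes "\<phi> \<in> borel_measurable borel"
  shows "integrable (empirical N x) \<phi>"
proof -
  have "x \<in> measurable (uniform_count_measure {1..N}) borel"
    by (simp add: measurable_def space_uniform_count_measure sets_uniform_count_measure)
  then show ?thesis
    unfolding empirical_def using assms
    by (subst integrable_distr_eq) (auto simp: uniform_count_measure_def integrable_point_measure_finite)
qed

lemma pair_empirical:
  fixes G :: "'a::euclidean_space \<times> 'a \<Rightarrow> real"
  assumes N: "1 \<le> N" and G: "G \<in> borel_measurable borel"
  shows "integrable (empirical N x \<Otimes>\<^sub>M empirical N x) G"
    and "(\<integral>z. G z \<partial>(empirical N x \<Otimes>\<^sub>M empirical N x))
      = 1 / (real N)\<^sup>2 * (\<Sum>i\<in>{1..N}. \<Sum>j\<in>{1..N}. G (x i, x j))"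
proof -
  note E = empirical_prob_measures[OF N, of x]
  interpret E: prob_space "empirical N x" using prob_measuresD E by blast
  interpret EE: pair_sigma_finite "empirical N x" "empirical N x" ..
  have sE[measurable_cong]: "sets (empirical N x) = sets borel" by (rule prob_measuresD(2)[OF E])
  have GP[measurable]: "G \<in> borel_measurable (empirical N x \<Otimes>\<^sub>M empirical N x)"
    using G prob_measuresD(2)[OF pair_prob_measures[OF E E]] measurable_cong_sets by blast
  have slice: "(\<lambda>y. g (G (z, y))) \<in> borel_measurable borel" if "g \<in> borel_measurable borel" for z and g :: "real \<Rightarrow> real"
  proof -
    have "(\<lambda>y. G (z, y)) \<in> borel_measurable borel"
      by (rule measurable_compose[OF borel_measurable_continuous_onI G]) (intro continuous_intros)
    then show ?thesis using that by (rule measurable_compose)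
  qed
  have int: "(\<lambda>z. \<integral>y. norm (G (z, y)) \<partial>empirical N x) \<in> borel_measurable borel"
    "(\<lambda>z. \<integral>y. G (z, y) \<partial>empirical N x) \<in> borel_measurable borel"
    using E.borel_measurable_lebesgue_integral[of "\<lambda>z y. norm (G (z, y))" "empirical N x"]
      E.borel_measurable_lebesgue_integral[of "\<lambda>z y. G (z, y)" "empirical N x"]
      measurable_cong_sets[OF sE refl] by simp_all
  show iG: "integrable (empirical N x \<Otimes>\<^sub>M empirical N x) G"
    by (intro EE.Fubini_integrable GP integrable_empirical int AE_I2 slice[of "\<lambda>t. t"]) auto
  have "(\<integral>z. G z \<partial>(empirical N x \<Otimes>\<^sub>M empirical N x)) = (\<integral>z. \<integral>y. G (z, y) \<partial>empirical N x \<partial>empirical N x)"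
    using EE.integral_fst'[OF iG] by simp
  also have "\<dots> = 1 / real N * (\<Sum>i\<in>{1..N}. \<integral>y. G (x i, y) \<partial>empirical N x)"
    by (rule integral_empirical[OF int(2)])
  also have "\<dots> = 1 / real N * (\<Sum>i\<in>{1..N}. 1 / real N * (\<Sum>j\<in>{1..N}. G (x i, x j)))"
    by (simp add: integral_empirical[OF slice[of "\<lambda>t. t"]])
  also have "\<dots> = 1 / (real N)\<^sup>2 * (\<Sum>i\<in>{1..N}. \<Sum>j\<in>{1..N}. G (x i, x j))"
    by (simp add: power2_eq_square sum_divide_distrib flip: sum_distrib_left)
  finally show "(\<integral>z. G z \<partial>(empirical N x \<Otimes>\<^sub>M empirical N x))
      = 1 / (real N)\<^sup>2 * (\<Sum>i\<in>{1..N}. \<Sum>j\<in>{1..N}. G (x i, x j))" .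
qed

lemma average_antisymmetric:
  fixes k :: "'i \<Rightarrow> 'i \<Rightarrow> real"
  assumes "\<And>i j. k j i = - k i j"
  shows "(\<Sum>i\<in>A. \<Sum>j\<in>A. (w i - w j) * k i j) = 2 * (\<Sum>i\<in>A. \<Sum>j\<in>A. w i * k i j)"
proof -
  have "(\<Sum>i\<in>A. \<Sum>j\<in>A. w j * k i j) = (\<Sum>j\<in>A. \<Sum>i\<in>A. w j * k i j)" by (rule sum.swap)
  also have "\<dots> = (\<Sum>j\<in>A. \<Sum>i\<in>A. - (w j * k j i))"
  proof (intro sum.cong refl)
    fix j i
    show "w j * k i j = - (w j * k j i)" by (subst assms[of j i]) simp
  qed
  also have "\<dots> = - (\<Sum>j\<in>A. \<Sum>i\<in>A. w j * k j i)" by (simp only: sum_negf)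
  finally show ?thesis by (simp add: left_diff_distrib sum_subtractf)
qed

lemma abs_average_le_sqrt:
  fixes u v :: "nat \<Rightarrow> real"
  assumes "\<And>i. \<bar>u i\<bar> \<le> v i"
  shows "\<bar>1 / real N * (\<Sum>i\<in>{1..N}. u i)\<bar> \<le> sqrt (1 / real N * (\<Sum>i\<in>{1..N}. (v i)\<^sup>2))"
proof (cases "N = 0")
  case False
  have sq: "(u i)\<^sup>2 \<le> (v i)\<^sup>2" for i using power_mono[OF assms[of i], of 2] by simp
  have "(\<Sum>i\<in>{1..N}. u i)\<^sup>2 \<le> (\<Sum>i\<in>{1..N}. 1\<^sup>2) * (\<Sum>i\<in>{1..N}. (u i)\<^sup>2)"
    using Cauchy_Schwarz_ineq_sum[of "\<lambda>_. 1" u "{1..N}"] by simp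
  also have "\<dots> \<le> real N * (\<Sum>i\<in>{1..N}. (v i)\<^sup>2)"
    using sq by (auto intro!: mult_left_mono sum_mono)
  finally have "(1 / real N)\<^sup>2 * (\<Sum>i\<in>{1..N}. u i)\<^sup>2 \<le> (1 / real N)\<^sup>2 * (real N * (\<Sum>i\<in>{1..N}. (v i)\<^sup>2))"
    by (intro mult_left_mono) auto
  also have "\<dots> = 1 / real N * (\<Sum>i\<in>{1..N}. (v i)\<^sup>2)" using False by (simp add: power2_eq_square)
  finally have "(1 / real N * (\<Sum>i\<in>{1..N}. u i))\<^sup>2 \<le> 1 / real N * (\<Sum>i\<in>{1..N}. (v i)\<^sup>2)"
    by (simp only: power_mult_distrib)
  then show ?thesis by (metis real_sqrt_abs real_sqrt_le_mono)
qed simp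

section \<open>Measurability of the gradient\<close>

text \<open>
  Local integrability of the gradient includes its measurability. As \<open>\<rho>\<close> is not assumed
  complete, this does not follow from the gradient being zero almost everywhere. It holds because
  the domain of absolute convergence is itself measurable.
\<close>

lemma borel_measurable_mmd_gradient:
  fixes \<mu> \<rho> :: "'a::euclidean_space measure"
  assumes mu: "\<mu> \<in> prob_measures" and rho: "\<rho> \<in> prob_measures"
  shows "mmd_gradient q \<mu> \<rho> \<in> borel_measurable borel"
proof -
  interpret mu: prob_space \<mu> using prob_measuresD mu by blast
  interpret rho: prob_space \<rho> using prob_measuresD rho by blast
  have eq: "sets \<mu> = sets \<rho>" "sets \<rho> = sets borel" using prob_measuresD(2)[OF mu] prob_measuresD(2)[OF rho] by auto
  note fin = rho.finite_measure_axioms mu.finite_measure_axioms eq(1)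
  have [measurable_cong]: "sets (signed_pos \<rho> \<mu>) = sets borel" "sets (signed_neg \<rho> \<mu>) = sets borel"
    using sets_signed_pos[OF fin] sets_signed_neg[OF fin] eq by auto
  have finite_le: "finite_measure L" if "L \<le> M" "sets L = sets M" "finite_measure M" for L M :: "'a measure"
  proof
    interpret M: finite_measure M by fact
    have "emeasure L (space L) \<le> emeasure M (space M)"
      using that le_measureD3[OF that(1)] sets_eq_imp_space_eq[OF that(2)] by auto
    also have "\<dots> < \<infinity>" using M.emeasure_finite[of "space M"] by (simp add: less_top[symmetric])
    finally show "emeasure L (space L) \<noteq> \<infinity>" by simp
  qed
  interpret p: finite_measure "signed_pos \<rho> \<mu>"
    using finite_le signed_pos_le[OF fin] sets_signed_pos[OF fin] fin by blast
  interpret n: finite_measure "signed_neg \<rho> \<mu>"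
    using finite_le signed_neg_le[OF fin] sets_signed_neg[OF fin] fin by metis
  show ?thesis
    unfolding mmd_gradient_def[abs_def] signed_integrable_def signed_integral_def by measurable
qed


section \<open>Passage to the limit\<close>

text \<open>
  The moment bound \<open>tight\<close> treats all \<open>q\<close> alike. For \<open>q \<le> 1\<close> the weight is the constant 1 and the
  bound is no restriction; for \<open>q > 1\<close> it controls a moment of order \<open>(q - 1) * s > q - 1\<close>.
\<close>

locale vanishing_residual_limit = singular_target q b C \<mu>
  for q b C :: real and \<mu> :: "'a::euclidean_space measure" +
  fixes X :: "nat \<Rightarrow> nat \<Rightarrow> 'a" and \<rho> :: "'a measure" and s S :: real
  assumes \<rho>: "\<rho> \<in> prob_measures"
    and narrow: "converges_narrowly (\<lambda>N. empirical N (X N)) \<rho>"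
    and s: "1 < s"
    and tight: "\<And>N. 2 \<le> N \<Longrightarrow> (\<integral>x. (1 + norm x) powr (max 0 (q - 1) * s) \<partial>empirical N (X N)) \<le> S"
    and residual: "(\<lambda>N. (1 / real N) * (\<Sum>i\<in>{1..N}. (norm (particle_residual q \<mu> N (X N) i))\<^sup>2)) \<longlonglongrightarrow> 0"
begin

abbreviation w :: "'a \<Rightarrow> real" where "w x \<equiv> (1 + norm x) powr (max 0 (q - 1) * s)"

lemma sets_rho[measurable_cong]: "sets \<rho> = sets borel" by (rule prob_measuresD(2)[OF \<rho>])

lemma weight_continuous: "continuous_on UNIV w"
proof -
  have "1 + norm x \<noteq> 0" for x :: 'a using norm_ge_zero[of x] by linarith
  then show ?thesis by (intro continuous_intros) auto
qed

lemma weight_measurable: "w \<in> borel_measurable borel"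
  by (rule borel_measurable_continuous_onI[OF weight_continuous])

lemma weight_integrable: "integrable \<rho> w"
  by (rule narrow_moment_bound[OF narrow _ \<rho> weight_continuous, where nmin=2 and S=S])
     (auto simp: empirical_prob_measures integrable_empirical weight_measurable tight)

lemma weight_le: "(1 + norm x) powr max 0 (q - 1) \<le> w x"
  using s by (intro powr_mono) (auto simp: mult_le_cancel_left1)

lemma pair_weight_continuous: "continuous_on UNIV (\<lambda>z. c * (w (fst z) * w (snd z)))"
  by (intro continuous_intros continuous_on_compose2[OF weight_continuous]) auto

lemma pair_weight_bound:
  assumes N: "2 \<le> N" and c: "0 \<le> c"
  shows "integrable (empirical N (X N) \<Otimes>\<^sub>M empirical N (X N)) (\<lambda>z. c * (w (fst z) * w (snd z)))"
    and "(\<integral>z. c * (w (fst z) * w (snd z)) \<partial>(empirical N (X N) \<Otimes>\<^sub>M empirical N (X N))) \<le> c * S\<^sup>2"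
proof -
  have N1: "1 \<le> N" using N by simp
  note m = borel_measurable_continuous_onI[OF pair_weight_continuous[of c]]
  show "integrable (empirical N (X N) \<Otimes>\<^sub>M empirical N (X N)) (\<lambda>z. c * (w (fst z) * w (snd z)))"
    by (rule pair_empirical(1)[OF N1 m])
  have "(\<integral>z. c * (w (fst z) * w (snd z)) \<partial>(empirical N (X N) \<Otimes>\<^sub>M empirical N (X N)))
      = c * (1 / real N * (\<Sum>i\<in>{1..N}. w (X N i)))\<^sup>2"
    unfolding pair_empirical(2)[OF N1 m]
    by (simp add: power2_eq_square sum_product sum_distrib_left mult_ac)
  also have "1 / real N * (\<Sum>i\<in>{1..N}. w (X N i)) = (\<integral>x. w x \<partial>empirical N (X N))"
    by (rule integral_empirical[OF weight_measurable, symmetric])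
  also have "c * (\<integral>x. w x \<partial>empirical N (X N))\<^sup>2 \<le> c * S\<^sup>2"
    using tight[OF N] c by (intro mult_left_mono power_mono Bochner_Integration.integral_nonneg) auto
  finally show "(\<integral>z. c * (w (fst z) * w (snd z)) \<partial>(empirical N (X N) \<Otimes>\<^sub>M empirical N (X N))) \<le> c * S\<^sup>2" .
qed

lemma pair_prob:
  "2 \<le> N \<Longrightarrow> empirical N (X N) \<Otimes>\<^sub>M empirical N (X N) \<in> prob_measures"
  "\<rho> \<Otimes>\<^sub>M \<rho> \<in> prob_measures"
  by (simp_all add: pair_prob_measures empirical_prob_measures \<rho>)

lemma pair_narrow: "converges_narrowly (\<lambda>N. empirical N (X N) \<Otimes>\<^sub>M empirical N (X N)) (\<rho> \<Otimes>\<^sub>M \<rho>)"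
  by (rule narrow_pair[OF narrow _ \<rho>, where nmin=2]) (simp add: empirical_prob_measures)

lemma pair_weight_integrable: "integrable (\<rho> \<Otimes>\<^sub>M \<rho>) (\<lambda>z. w (fst z) * w (snd z))"
  using narrow_moment_bound(1)[OF pair_narrow pair_prob(1) pair_prob(2) pair_weight_continuous[of 1] _ pair_weight_bound]
  by simp

text \<open>
  The identity \<open>1/N * (\<Sum>i. \<psi> (x i) * (b i \<bullet> e)) = \<integral> \<psi> (target_force \<bullet> e) - 1/2 * \<integral>\<integral> interaction\<close>
  holds for each empirical measure. The left-hand side tends to 0, and on the right-hand side both
  integrands are continuous and have a bounded moment of order \<open>s\<close>.
\<close>

lemma weak_form:
  assumes \<psi>: "L-lipschitz_on UNIV \<psi>" "\<And>x. \<bar>\<psi> x\<bar> \<le> 1" and e: "norm e \<le> 1"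
  shows "(\<integral>x. \<psi> x * (target_force x \<bullet> e) \<partial>\<rho>) = (1 / 2) * (\<integral>z. interaction q \<psi> e z \<partial>(\<rho> \<Otimes>\<^sub>M \<rho>))"
proof -
  let ?a = "max 0 (q - 1)"
  have L: "0 \<le> L" using lipschitz_on_nonneg \<psi>(1) .
  obtain K where K: "0 \<le> K" "\<And>x. norm (target_force x) \<le> K * (1 + norm x) powr ?a" using target_force_growth by blast
  have c\<psi>: "continuous_on UNIV \<psi>" using lipschitz_on_continuous_on[OF \<psi>(1)] .
  define G where "G x = \<psi> x * (target_force x \<bullet> e)" for x
  have Gc: "continuous_on UNIV G"
    unfolding G_def by (intro continuous_intros c\<psi> target_force_continuous)
  have Gb: "\<bar>G x\<bar> powr s \<le> K powr s * w x" for x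
  proof -
    have "\<bar>target_force x \<bullet> e\<bar> \<le> norm (target_force x)"
      using Cauchy_Schwarz_ineq2[of "target_force x" e] mult_left_mono[OF e norm_ge_zero[of "target_force x"]] by simp
    then have "\<bar>G x\<bar> \<le> 1 * norm (target_force x)"
      unfolding G_def abs_mult using \<psi>(2) by (intro mult_mono) auto
    also have "\<dots> \<le> K * (1 + norm x) powr ?a" using K(2)[of x] by simp
    finally have "\<bar>G x\<bar> powr s \<le> (K * (1 + norm x) powr ?a) powr s" using s by (intro powr_mono2) auto
    then show ?thesis using K(1) by (simp add: powr_mult powr_powr)
  qed
  have limG: "(\<lambda>N. \<integral>x. G x \<partial>empirical N (X N)) \<longlonglongrightarrow> (\<integral>x. G x \<partial>\<rho>)"
  proof (rule narrow_integral_tendsto[OF narrow _ \<rho> _ _ _ Gc s Gb, where nmin=2 and S="K powr s * S"])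
    show "(\<integral>x. K powr s * w x \<partial>empirical N (X N)) \<le> K powr s * S" if "2 \<le> N" for N
      using tight[OF that] by (simp add: mult_left_mono)
  qed (auto intro!: empirical_prob_measures integrable_empirical borel_measurable_times weight_measurable continuous_on_mult_left weight_continuous)
  define k where "k = q * (2 + L)"
  have k: "0 \<le> k" using q L by (simp add: k_def)
  have Hb: "\<bar>interaction q \<psi> e z\<bar> powr s \<le> k powr s * (w (fst z) * w (snd z))" for z
  proof -
    have "\<bar>interaction q \<psi> e z\<bar> powr s \<le> (k * ((1 + norm (fst z)) powr ?a * (1 + norm (snd z)) powr ?a)) powr s"
      using interaction_growth[OF q(1) \<psi> e, of z] s by (intro powr_mono2) (auto simp: k_def)
    then show ?thesis using k by (simp add: powr_mult powr_powr)
  qed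
  have Hc: "continuous_on UNIV (interaction q \<psi> e)" by (rule interaction_continuous[OF q \<psi>(1) e])
  have limH: "(\<lambda>N. \<integral>z. interaction q \<psi> e z \<partial>(empirical N (X N) \<Otimes>\<^sub>M empirical N (X N)))
      \<longlonglongrightarrow> (\<integral>z. interaction q \<psi> e z \<partial>(\<rho> \<Otimes>\<^sub>M \<rho>))"
    by (rule narrow_integral_tendsto[OF pair_narrow pair_prob pair_weight_continuous pair_weight_bound Hc s Hb]) auto
  define R where "R N = 1 / real N * (\<Sum>i\<in>{1..N}. \<psi> (X N i) * (particle_residual q \<mu> N (X N) i \<bullet> e))" for N
  have "R \<longlonglongrightarrow> 0"
  proof (rule Lim_null_comparison)
    have "\<bar>\<psi> x * (v \<bullet> e)\<bar> \<le> norm v" for x v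
    proof -
      have "\<bar>v \<bullet> e\<bar> \<le> norm v"
        using Cauchy_Schwarz_ineq2[of v e] mult_left_mono[OF e norm_ge_zero[of v]] by simp
      then show ?thesis using mult_mono[OF \<psi>(2)[of x]] by (simp add: abs_mult)
    qed
    then show "\<forall>\<^sub>F N in sequentially. norm (R N) \<le> sqrt ((1 / real N) * (\<Sum>i\<in>{1..N}. (norm (particle_residual q \<mu> N (X N) i))\<^sup>2))"
      unfolding R_def real_norm_def by (intro always_eventually allI abs_average_le_sqrt)
    show "(\<lambda>N. sqrt ((1 / real N) * (\<Sum>i\<in>{1..N}. (norm (particle_residual q \<mu> N (X N) i))\<^sup>2))) \<longlonglongrightarrow> 0"
      using tendsto_real_sqrt[OF residual] by simp
  qed
  moreover have "R \<longlonglongrightarrow> (\<integral>x. G x \<partial>\<rho>) - (1 / 2) * (\<integral>z. interaction q \<psi> e z \<partial>(\<rho> \<Otimes>\<^sub>M \<rho>))"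
  proof (rule Lim_transform_eventually)
    show "(\<lambda>N. (\<integral>x. G x \<partial>empirical N (X N)) - (1 / 2) * (\<integral>z. interaction q \<psi> e z \<partial>(empirical N (X N) \<Otimes>\<^sub>M empirical N (X N))))
      \<longlonglongrightarrow> (\<integral>x. G x \<partial>\<rho>) - (1 / 2) * (\<integral>z. interaction q \<psi> e z \<partial>(\<rho> \<Otimes>\<^sub>M \<rho>))"
      by (intro tendsto_intros limG limH)
    show "\<forall>\<^sub>F N in sequentially. (\<integral>x. G x \<partial>empirical N (X N)) - (1 / 2) * (\<integral>z. interaction q \<psi> e z \<partial>(empirical N (X N) \<Otimes>\<^sub>M empirical N (X N))) = R N"
      using eventually_ge_at_top[of 1]
    proof eventually_elim
      case (elim N)
      let ?x = "X N"
      let ?f = "\<lambda>i j. grad_kernel q (?x i - ?x j) \<bullet> e"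
      have anti: "?f j i = - ?f i j" for i j
        using grad_kernel_uminus[of q "?x i - ?x j"] by simp
      \<comment> \<open>The kernel gradient vanishes at the origin, so the sum may include \<open>j = i\<close>.\<close>
      have res: "particle_residual q \<mu> N ?x i \<bullet> e = target_force (?x i) \<bullet> e - 1 / real N * (\<Sum>j\<in>{1..N}. ?f i j)" for i
      proof -
        have "(\<Sum>j\<in>{1..N} - {i}. grad_kernel q (?x i - ?x j)) = (\<Sum>j\<in>{1..N}. grad_kernel q (?x i - ?x j))"
          by (intro sum.mono_neutral_left) (auto simp: grad_kernel_def)
        then show ?thesis
          by (simp add: particle_residual_def target_force_def inner_diff_left inner_add_left inner_sum_left)
      qed
      have "R N = 1 / real N * (\<Sum>i\<in>{1..N}. G (?x i)) - 1 / (real N)\<^sup>2 * (\<Sum>i\<in>{1..N}. \<Sum>j\<in>{1..N}. \<psi> (?x i) * ?f i j)"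
        by (simp add: R_def res G_def right_diff_distrib sum_subtractf power2_eq_square sum_divide_distrib sum_distrib_left ac_simps)
      also have "(\<Sum>i\<in>{1..N}. \<Sum>j\<in>{1..N}. \<psi> (?x i) * ?f i j) = 1 / 2 * (\<Sum>i\<in>{1..N}. \<Sum>j\<in>{1..N}. interaction q \<psi> e (?x i, ?x j))"
        using average_antisymmetric[of ?f "\<lambda>i. \<psi> (?x i)" "{1..N}", OF anti] by (simp add: interaction_def)
      finally show ?case
        by (simp add: integral_empirical[OF borel_measurable_continuous_onI[OF Gc]]
            pair_empirical(2)[OF elim borel_measurable_continuous_onI[OF Hc]])
    qed
  qed
  ultimately have "0 = (\<integral>x. G x \<partial>\<rho>) - (1 / 2) * (\<integral>z. interaction q \<psi> e z \<partial>(\<rho> \<Otimes>\<^sub>M \<rho>))"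
    by (rule LIMSEQ_unique)
  then show ?thesis by (simp add: G_def)
qed

lemma force_measurable: "(\<lambda>z. grad_kernel q (fst z - snd z)) \<in> borel_measurable (\<rho> \<Otimes>\<^sub>M \<rho>)"
  by measurable

text \<open>
  For \<open>q < 1\<close> the energy is tested with the bounded continuous kernels in which the distance is
  replaced by its maximum with \<open>\<epsilon> = 1/(n + 1)\<close>. Off the diagonal they lie below the singular kernel.
  Their value on the diagonal is large, but the \<open>N\<close> diagonal pairs carry the factor \<open>1/N^2\<close>. So the
  limit measure satisfies the energy bound for every \<open>\<epsilon>\<close>, and monotone convergence concludes.
\<close>

lemma pair_force_integrable:
  assumes distinct: "\<And>N. 2 \<le> N \<Longrightarrow> inj_on (X N) {1..N}"
    and energy: "q < 1 \<Longrightarrow> bdd_above ((\<lambda>N. (1 / (real N)\<^sup>2) *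
            (\<Sum>i\<in>{1..N}. \<Sum>j\<in>{1..N} - {i}. 1 / norm (X N i - X N j) powr (1 - q))) ` {2..})"
  shows "integrable (\<rho> \<Otimes>\<^sub>M \<rho>) (\<lambda>z. grad_kernel q (fst z - snd z))"
proof (cases "1 \<le> q")
  case True
  show ?thesis
  proof (rule Bochner_Integration.integrable_bound[OF integrable_mult_right[OF pair_weight_integrable, of q]])
    show "AE z in \<rho> \<Otimes>\<^sub>M \<rho>. norm (grad_kernel q (fst z - snd z)) \<le> norm (q * (w (fst z) * w (snd z)))"
    proof (rule AE_I2)
      fix z :: "'a \<times> 'a"
      let ?u = "fst z - snd z"
      have "norm (grad_kernel q ?u) \<le> q * (1 + norm ?u) powr max 0 (q - 1)"
        using True q by (auto simp: norm_grad_kernel max_def intro!: mult_left_mono powr_mono2)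
      also have "\<dots> \<le> q * ((1 + norm (fst z)) powr max 0 (q - 1) * (1 + norm (snd z)) powr max 0 (q - 1))"
        using q by (intro mult_left_mono weight_submultiplicative) auto
      also have "\<dots> \<le> q * (w (fst z) * w (snd z))"
        using q by (intro mult_left_mono mult_mono weight_le) auto
      finally show "norm (grad_kernel q ?u) \<le> norm (q * (w (fst z) * w (snd z)))" by simp
    qed
  qed (rule force_measurable)
next
  case False
  then obtain T where T: "\<And>N. 2 \<le> N \<Longrightarrow> (1 / (real N)\<^sup>2) *
            (\<Sum>i\<in>{1..N}. \<Sum>j\<in>{1..N} - {i}. 1 / norm (X N i - X N j) powr (1 - q)) \<le> T"
    using energy by (force simp: bdd_above_def)
  define g where "g n z = max (1 / real (Suc n)) (norm (fst z - snd z)) powr (q - 1)" for n and z :: "'a \<times> 'a"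
  have gc: "continuous_on UNIV (g n)" for n
  proof -
    have "max (1 / real (Suc n)) t \<noteq> 0" for t by (metis less_max_iff_disj of_nat_0_less_iff zero_less_Suc zero_less_divide_1_iff less_irrefl)
    then show ?thesis unfolding g_def by (intro continuous_intros) auto
  qed
  have gb: "0 \<le> g n z" "g n z \<le> (1 / real (Suc n)) powr (q - 1)" for n z
    unfolding g_def using False by (auto intro!: powr_mono2')
  have pre: "(\<integral>z. g n z \<partial>(empirical N (X N) \<Otimes>\<^sub>M empirical N (X N))) \<le> T + (1 / real (Suc n)) powr (q - 1) * (1 / real N)"
    if N: "2 \<le> N" for n N
  proof -
    let ?e = "(1 / real (Suc n)) powr (q - 1)"
    have row: "(\<Sum>j\<in>{1..N}. g n (X N i, X N j)) \<le> (\<Sum>j\<in>{1..N} - {i}. 1 / norm (X N i - X N j) powr (1 - q)) + ?e"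
      if i: "i \<in> {1..N}" for i
    proof -
      have "(\<Sum>j\<in>{1..N}. g n (X N i, X N j)) = g n (X N i, X N i) + (\<Sum>j\<in>{1..N} - {i}. g n (X N i, X N j))"
        using i by (intro sum.remove) auto
      also have "(\<Sum>j\<in>{1..N} - {i}. g n (X N i, X N j)) \<le> (\<Sum>j\<in>{1..N} - {i}. 1 / norm (X N i - X N j) powr (1 - q))"
      proof (rule sum_mono)
        fix j assume j: "j \<in> {1..N} - {i}"
        then have "X N i \<noteq> X N j" using inj_onD[OF distinct[OF N], of i j] i by auto
        then have "g n (X N i, X N j) \<le> norm (X N i - X N j) powr (q - 1)"
          unfolding g_def using False by (auto intro!: powr_mono2')
        also have "\<dots> = 1 / norm (X N i - X N j) powr (1 - q)"
          using powr_minus_divide[of "norm (X N i - X N j)" "1 - q"] by simp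
        finally show "g n (X N i, X N j) \<le> 1 / norm (X N i - X N j) powr (1 - q)" .
      qed
      finally show ?thesis using gb(2)[of n "(X N i, X N i)"] by linarith
    qed
    have "(\<Sum>i\<in>{1..N}. \<Sum>j\<in>{1..N}. g n (X N i, X N j))
      \<le> (\<Sum>i\<in>{1..N}. (\<Sum>j\<in>{1..N} - {i}. 1 / norm (X N i - X N j) powr (1 - q)) + ?e)"
      by (intro sum_mono row)
    also have "\<dots> = (\<Sum>i\<in>{1..N}. \<Sum>j\<in>{1..N} - {i}. 1 / norm (X N i - X N j) powr (1 - q)) + real N * ?e"
      by (simp add: sum.distrib)
    finally have "1 / (real N)\<^sup>2 * (\<Sum>i\<in>{1..N}. \<Sum>j\<in>{1..N}. g n (X N i, X N j))
      \<le> 1 / (real N)\<^sup>2 * ((\<Sum>i\<in>{1..N}. \<Sum>j\<in>{1..N} - {i}. 1 / norm (X N i - X N j) powr (1 - q)) + real N * ?e)"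
      by (intro mult_left_mono) auto
    also have "\<dots> \<le> T + ?e * (1 / real N)"
      using T[OF N] N unfolding distrib_left by (simp add: power2_eq_square)
    finally show ?thesis
      using N by (simp add: pair_empirical(2)[OF _ borel_measurable_continuous_onI[OF gc]])
  qed
  have lim: "(\<integral>z. g n z \<partial>(\<rho> \<Otimes>\<^sub>M \<rho>)) \<le> T" for n
  proof (rule LIMSEQ_le)
    have "bounded (range (g n))"
      unfolding bounded_iff using gb by (intro exI[of _ "(1 / real (Suc n)) powr (q - 1)"]) auto
    then show "(\<lambda>N. \<integral>z. g n z \<partial>(empirical N (X N) \<Otimes>\<^sub>M empirical N (X N))) \<longlonglongrightarrow> (\<integral>z. g n z \<partial>(\<rho> \<Otimes>\<^sub>M \<rho>))"
      using pair_narrow gc unfolding converges_narrowly_def by blast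
    have "(\<lambda>N. T + (1 / real (Suc n)) powr (q - 1) * (1 / real N)) \<longlonglongrightarrow> T + (1 / real (Suc n)) powr (q - 1) * 0"
      by (intro tendsto_intros lim_1_over_n)
    then show "(\<lambda>N. T + (1 / real (Suc n)) powr (q - 1) * (1 / real N)) \<longlonglongrightarrow> T" by simp
  qed (use pre in blast)
  have gm[measurable]: "g n \<in> borel_measurable (\<rho> \<Otimes>\<^sub>M \<rho>)" for n
    using borel_measurable_continuous_onI[OF gc] prob_measuresD(2)[OF pair_prob(2)] measurable_cong_sets by blast
  have "(\<integral>\<^sup>+z. ennreal (norm (fst z - snd z) powr (q - 1)) \<partial>(\<rho> \<Otimes>\<^sub>M \<rho>)) \<le> (\<integral>\<^sup>+z. (SUP n. ennreal (g n z)) \<partial>(\<rho> \<Otimes>\<^sub>M \<rho>))"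
  proof (rule nn_integral_mono)
    fix z :: "'a \<times> 'a"
    show "ennreal (norm (fst z - snd z) powr (q - 1)) \<le> (SUP n. ennreal (g n z))"
    proof (cases "fst z = snd z")
      case False
      then obtain n where n: "1 / real (Suc n) < norm (fst z - snd z)"
        using reals_Archimedean[of "norm (fst z - snd z)"] by (auto simp: inverse_eq_divide)
      then have "ennreal (norm (fst z - snd z) powr (q - 1)) = ennreal (g n z)" by (simp add: g_def max_def)
      also have "\<dots> \<le> (SUP n. ennreal (g n z))" by (rule SUP_upper) simp
      finally show ?thesis .
    qed simp
  qed
  also have "\<dots> = (SUP n. \<integral>\<^sup>+z. ennreal (g n z) \<partial>(\<rho> \<Otimes>\<^sub>M \<rho>))"
  proof (rule nn_integral_monotone_convergence_SUP)
    show "incseq (\<lambda>n z. ennreal (g n z))"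
    proof (intro incseq_SucI le_funI ennreal_leI)
      fix n and z :: "'a \<times> 'a"
      have "1 / real (Suc (Suc n)) \<le> 1 / real (Suc n)" by (simp add: field_simps)
      then show "g n z \<le> g (Suc n) z"
        unfolding g_def using False by (intro powr_mono2') (auto intro: less_max_iff_disj[THEN iffD2])
    qed
  qed measurable
  also have "\<dots> \<le> ennreal T"
  proof (rule SUP_least)
    fix n
    have "integrable (\<rho> \<Otimes>\<^sub>M \<rho>) (g n)"
      by (rule integrable_continuous_bounded[OF pair_prob(2) gc, where B="(1 / real (Suc n)) powr (q - 1)"])
         (use gb in auto)
    then have "(\<integral>\<^sup>+z. ennreal (g n z) \<partial>(\<rho> \<Otimes>\<^sub>M \<rho>)) = ennreal (\<integral>z. g n z \<partial>(\<rho> \<Otimes>\<^sub>M \<rho>))"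
      using gb by (intro nn_integral_eq_integral) auto
    then show "(\<integral>\<^sup>+z. ennreal (g n z) \<partial>(\<rho> \<Otimes>\<^sub>M \<rho>)) \<le> ennreal T" using lim by (simp add: ennreal_leI)
  qed
  finally have "(\<integral>\<^sup>+z. ennreal (norm (fst z - snd z) powr (q - 1)) \<partial>(\<rho> \<Otimes>\<^sub>M \<rho>)) < \<infinity>"
    by (simp add: le_less_trans)
  then have "integrable (\<rho> \<Otimes>\<^sub>M \<rho>) (\<lambda>z. q * norm (fst z - snd z) powr (q - 1))"
    by (intro integrable_mult_right integrableI_bounded) auto
  then show ?thesis
    by (rule Bochner_Integration.integrable_bound[OF _ force_measurable])
       (use q in \<open>auto simp: norm_grad_kernel\<close>)
qed

text \<open>
  Once the unsymmetrised kernel is integrable for \<open>\<rho> \<otimes> \<rho>\<close>, exchanging the two variables turns the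
  double integral of the interaction into twice \<open>\<integral> \<psi> (F \<bullet> e) d\<rho>\<close>, where \<open>F\<close> is the force exerted by
  \<open>\<rho>\<close> itself, and the weak form says that \<open>F\<close> and the force of the target agree against all tests.
\<close>

lemma limit_is_critical:
  assumes "integrable (\<rho> \<Otimes>\<^sub>M \<rho>) (\<lambda>z. grad_kernel q (fst z - snd z))"
  shows "lagrangian_critical_point q \<mu> \<rho>"
proof -
  interpret rho: prob_space \<rho> using prob_measuresD \<rho> by blast
  interpret PP: pair_sigma_finite \<rho> \<rho> ..
  note fi = assms
  define F where "F x = (\<integral>y. grad_kernel q (x - y) \<partial>\<rho>)" for x
  have slice: "AE x in \<rho>. integrable \<rho> (\<lambda>y. grad_kernel q (x - y))"
    using PP.AE_integrable_fst'[OF fi] by simp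
  have Fi: "integrable \<rho> F"
    using PP.integrable_fst'[OF fi] by (simp add: F_def[abs_def])
  obtain K where K: "0 \<le> K" "\<And>x. norm (target_force x) \<le> K * (1 + norm x) powr max 0 (q - 1)" using target_force_growth by blast
  have [measurable]: "target_force \<in> borel_measurable borel"
    by (rule borel_measurable_continuous_onI[OF target_force_continuous])
  have Vi: "integrable \<rho> target_force"
  proof (rule Bochner_Integration.integrable_bound[OF integrable_mult_right[OF weight_integrable, of K]])
    show "AE x in \<rho>. norm (target_force x) \<le> norm (K * w x)"
      using K weight_le by (intro AE_I2) (auto intro!: order_trans[OF K(2)] mult_left_mono)
  qed measurable
  have test: "(\<integral>x. \<psi> x * ((F x - target_force x) \<bullet> e) \<partial>\<rho>) = 0"
    if \<psi>: "L-lipschitz_on UNIV \<psi>" "\<And>x. \<bar>\<psi> x\<bar> \<le> 1" and e: "norm e \<le> 1" for L \<psi> e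
  proof -
    have [measurable]: "\<psi> \<in> borel_measurable borel"
      by (rule borel_measurable_continuous_onI[OF lipschitz_on_continuous_on[OF \<psi>(1)]])
    let ?P = "\<rho> \<Otimes>\<^sub>M \<rho>"
    have bdd: "integrable M (\<lambda>z. \<psi> (g z) * h z)" if "integrable M h" "g \<in> M \<rightarrow>\<^sub>M borel" for M and h :: "_ \<Rightarrow> real" and g
      using that(1)
    proof (rule Bochner_Integration.integrable_bound)
      show "AE z in M. norm (\<psi> (g z) * h z) \<le> norm (h z)"
        using \<psi>(2) by (intro AE_I2) (auto simp: abs_mult intro: mult_left_le_one_le)
      note [measurable] = that(2) borel_measurable_integrable[OF that(1)]
      show "(\<lambda>z. \<psi> (g z) * h z) \<in> borel_measurable M" by measurable
    qed
    let ?k = "\<lambda>z. grad_kernel q (fst z - snd z) \<bullet> e"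
    have ki: "integrable ?P ?k" using fi by simp
    have i1: "integrable ?P (\<lambda>z. \<psi> (fst z) * ?k z)" by (rule bdd[OF ki]) measurable
    have i2: "integrable ?P (\<lambda>z. \<psi> (snd z) * ?k z)" by (rule bdd[OF ki]) measurable
    have "(\<integral>z. \<psi> (snd z) * ?k z \<partial>?P) = (\<integral>(x, y). \<psi> x * (grad_kernel q (y - x) \<bullet> e) \<partial>?P)"
      using PP.integral_product_swap[OF borel_measurable_integrable[OF i2]] by simp
    also have "\<dots> = (\<integral>z. - (\<psi> (fst z) * ?k z) \<partial>?P)"
    proof (rule Bochner_Integration.integral_cong[OF refl], clarsimp)
      fix x y :: 'a
      show "\<psi> x * (grad_kernel q (y - x) \<bullet> e) = - (\<psi> x * (grad_kernel q (x - y) \<bullet> e))"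
        using grad_kernel_uminus[of q "x - y"] by simp
    qed
    finally have swap: "(\<integral>z. \<psi> (snd z) * ?k z \<partial>?P) = - (\<integral>z. \<psi> (fst z) * ?k z \<partial>?P)" by simp
    have "(\<integral>z. interaction q \<psi> e z \<partial>?P) = (\<integral>z. \<psi> (fst z) * ?k z - \<psi> (snd z) * ?k z \<partial>?P)"
      by (simp add: interaction_def left_diff_distrib)
    also have "\<dots> = 2 * (\<integral>z. \<psi> (fst z) * ?k z \<partial>?P)"
      using i1 i2 swap by simp
    also have "(\<integral>z. \<psi> (fst z) * ?k z \<partial>?P) = (\<integral>x. \<integral>y. \<psi> x * (grad_kernel q (x - y) \<bullet> e) \<partial>\<rho> \<partial>\<rho>)"
      using PP.integral_fst'[OF i1] by simp
    also have "\<dots> = (\<integral>x. \<psi> x * (F x \<bullet> e) \<partial>\<rho>)"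
    proof (rule integral_cong_AE)
      show "AE x in \<rho>. (\<integral>y. \<psi> x * (grad_kernel q (x - y) \<bullet> e) \<partial>\<rho>) = \<psi> x * (F x \<bullet> e)"
        using slice by eventually_elim (simp add: F_def)
      show "(\<lambda>x. \<integral>y. \<psi> x * (grad_kernel q (x - y) \<bullet> e) \<partial>\<rho>) \<in> borel_measurable \<rho>"
        by measurable
      show "(\<lambda>x. \<psi> x * (F x \<bullet> e)) \<in> borel_measurable \<rho>"
        using Fi by measurable
    qed
    finally have "(\<integral>x. \<psi> x * (target_force x \<bullet> e) \<partial>\<rho>) = (\<integral>x. \<psi> x * (F x \<bullet> e) \<partial>\<rho>)"
      using weak_form[OF \<psi> e] by simp
    moreover have "integrable \<rho> (\<lambda>x. target_force x \<bullet> e)" "integrable \<rho> (\<lambda>x. F x \<bullet> e)"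
      using Vi Fi by auto
    then have "integrable \<rho> (\<lambda>x. \<psi> x * (target_force x \<bullet> e))" "integrable \<rho> (\<lambda>x. \<psi> x * (F x \<bullet> e))"
      by - (rule bdd, assumption, measurable)+
    ultimately show ?thesis by (simp add: inner_diff_left right_diff_distrib)
  qed
  have "AE x in \<rho>. \<forall>e\<in>Basis. (F x - target_force x) \<bullet> e = 0"
  proof (rule AE_finite_allI)
    fix e :: 'a assume e: "e \<in> Basis"
    show "AE x in \<rho>. (F x - target_force x) \<bullet> e = 0"
    proof (rule AE_zero_if_lipschitz_tests_vanish[OF \<rho>])
      show "integrable \<rho> (\<lambda>x. (F x - target_force x) \<bullet> e)" using Fi Vi by simp
      show "(\<integral>x. \<psi> x * ((F x - target_force x) \<bullet> e) \<partial>\<rho>) = 0"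
        if "L-lipschitz_on UNIV \<psi>" "\<And>x. \<bar>\<psi> x\<bar> \<le> 1" for \<psi> L
        using that e by (intro test) auto
    qed
  qed simp
  then have FV: "AE x in \<rho>. F x - target_force x = 0"
  proof eventually_elim
    case (elim x)
    show ?case by (rule euclidean_eqI) (use elim in simp)
  qed
  have eq: "sets \<mu> = sets \<rho>" using sets_mu sets_rho by simp
  have si: "AE x in \<rho>. signed_integrable \<rho> \<mu> (\<lambda>y. grad_kernel q (x - y))"
    using slice
    by eventually_elim (rule signed_integrableI[OF rho.finite_measure_axioms finite_measure_axioms eq _ grad_kernel_integrable])
  have zero: "AE x in \<rho>. mmd_gradient q \<mu> \<rho> x = 0"
    using slice FV
  proof eventually_elim
    case (elim x)
    then show ?case
      using signed_integral_eq_diff[OF rho.finite_measure_axioms finite_measure_axioms eq elim(1) grad_kernel_integrable]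
      by (simp add: mmd_gradient_def F_def target_force_def)
  qed
  have gm: "mmd_gradient q \<mu> \<rho> \<in> borel_measurable \<rho>"
    using borel_measurable_mmd_gradient[OF \<mu> \<rho>] measurable_cong_sets[OF sets_rho refl] by blast
  have "integrable \<rho> (mmd_gradient q \<mu> \<rho>)"
    by (subst integrable_cong_AE[OF gm _ zero]) auto
  then have "set_integrable \<rho> K (mmd_gradient q \<mu> \<rho>)" if "compact K" for K
    unfolding set_integrable_def using that borel_compact sets_rho
    by (intro integrable_mult_indicator) auto
  then show ?thesis using si zero by (simp add: lagrangian_critical_point_def)
qed

end

section \<open>The integrability exponent of the target\<close>

text \<open>
  For finite \<open>p > 1\<close>, an exponent \<open>b > 1 - q\<close> as in \<open>riesz_potential_bounded\<close> exists iff
  \<open>1 - q < d * (1 - 1 / p)\<close>. Under the first alternative the critical value \<open>d / (d + q - 2)\<close> is the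
  one for which \<open>d * (1 - 1 / p) = 2 - q\<close>, so \<open>b = 2 - q\<close> is admissible; under the third alternative
  \<open>1 / q\<close> is the value at which the two sides are equal.
\<close>

lemma singularity_exponent:
  fixes q d :: real and p :: ereal
  assumes q: "0 < q" "q < 2"
    and p: "(d + q - 2 > 0 \<and> ereal (d / (d + q - 2)) < p \<and> p \<le> \<infinity>)
          \<or> (d = 1 \<and> q = 1 \<and> p = \<infinity>)
          \<or> (d = 1 \<and> 0 < q \<and> q < 1 \<and> ereal (1 / q) < p \<and> p \<le> \<infinity>)"
  obtains b where "0 \<le> b" "1 - q < b"
    "p = \<infinity> \<and> b < d \<or> 1 < p \<and> p < \<infinity> \<and> b < d * (1 - 1 / real_of_ereal p)"
proof -
  consider (1) "d + q - 2 > 0" "ereal (d / (d + q - 2)) < p" | (2) "d = 1" "q = 1" "p = \<infinity>"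
    | (3) "d = 1" "q < 1" "ereal (1 / q) < p" using p by blast
  then show ?thesis
  proof cases
    case 1
    have d: "0 < d" using 1 q by linarith
    have "1 < d / (d + q - 2)" using 1 q by (simp add: field_simps)
    show ?thesis
    proof (cases p)
      case (real r)
      have r: "d / (d + q - 2) < r" using 1 real by simp
      moreover have "1 < r" using r \<open>1 < d / (d + q - 2)\<close> by linarith
      ultimately have r: "d / (d + q - 2) < r" "1 < r" .
      then have "d < r * (d + q - 2)" using 1 by (simp add: field_simps)
      then have "2 - q < d * (1 - 1 / r)" using r by (simp add: field_simps)
      then show ?thesis using real r q by (intro that[of "2 - q"]) auto
    qed (use 1 q in \<open>auto intro: that[of "2 - q"]\<close>)
  next
    case 2
    then show ?thesis by (intro that[of "1/2"]) auto
  next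
    case 3
    show ?thesis
    proof (cases p)
      case (real r)
      then have r: "1 / q < r" using 3 by simp
      moreover have "1 < 1 / q" using 3 q by simp
      ultimately have r1: "1 < r" by linarith
      have "1 - q < 1 - 1 / r" using r r1 q by (simp add: field_simps)
      then obtain b where "1 - q < b" "b < 1 - 1 / r" using dense by blast
      then show ?thesis using real r1 3 by (intro that[of b]) auto
    qed (use 3 q in \<open>auto intro: that[of "1 - q / 2"]\<close>)
  qed
qed

theorem proposition4p3:
  fixes q :: real and p :: ereal
    and m :: "'a::euclidean_space \<Rightarrow> real"
    and \<mu> \<rho> :: "'a measure"
    and X :: "nat \<Rightarrow> nat \<Rightarrow> 'a"
  assumes q: "0 < q" "q < 2"
    and p: "(real DIM('a) + q - 2 > 0 \<and>
               ereal (real DIM('a) / (real DIM('a) + q - 2)) < p \<and> p \<le> \<infinity>)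
          \<or> (DIM('a) = 1 \<and> q = 1 \<and> p = \<infinity>)
          \<or> (DIM('a) = 1 \<and> 0 < q \<and> q < 1 \<and> ereal (1 / q) < p \<and> p \<le> \<infinity>)"
    and \<mu>_density: "m \<in> Lp_space p" "AE x in lborel. 0 \<le> m x"
      "\<mu> = density lborel (\<lambda>x. ennreal (m x))"
    and \<mu>_prob: "\<mu> \<in> prob_measures_moment (max 1 q)"
    and distinct: "\<And>N. 2 \<le> N \<Longrightarrow> inj_on (X N) {1..N}"
    and \<rho>_prob: "\<rho> \<in> prob_measures"
    and narrow: "converges_narrowly (\<lambda>N. empirical N (X N)) \<rho>"
    and residual: "(\<lambda>N. (1 / real N) * (\<Sum>i\<in>{1..N}. (norm (particle_residual q \<mu> N (X N) i))\<^sup>2))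
          \<longlonglongrightarrow> 0"
    and energy: "0 < q \<and> q < 1 \<Longrightarrow>
          bdd_above ((\<lambda>N. (1 / (real N)\<^sup>2) *
            (\<Sum>i\<in>{1..N}. \<Sum>j\<in>{1..N} - {i}. 1 / norm (X N i - X N j) powr (1 - q))) ` {2..})"
    and moment: "1 < q \<and> q < 2 \<Longrightarrow>
          \<exists>r > q - 1. bdd_above ((\<lambda>N. \<integral>x. norm x powr r \<partial>empirical N (X N)) ` {2..})"
  shows "lagrangian_critical_point q \<mu> \<rho>"
proof -
  let ?a = "max 0 (q - 1)"
  have mu: "\<mu> \<in> prob_measures" and mom: "integrable \<mu> (\<lambda>x. norm x powr max 1 q)"
    using \<mu>_prob by (auto simp: prob_measures_moment_def)
  interpret mu: prob_space \<mu> using prob_measuresD mu by blast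
  have [measurable_cong]: "sets \<mu> = sets borel" by (rule prob_measuresD(2)[OF mu])
  obtain b where b: "0 \<le> b" "1 - q < b"
    "p = \<infinity> \<and> b < real DIM('a) \<or> 1 < p \<and> p < \<infinity> \<and> b < real DIM('a) * (1 - 1 / real_of_ereal p)"
    using singularity_exponent[of q "real DIM('a)" p] q p by auto
  obtain C where C: "0 \<le> C" "\<And>x. (\<integral>\<^sup>+y. ennreal (norm (x - y) powr (- b)) \<partial>\<mu>) \<le> ennreal C"
    using riesz_potential_bounded[OF \<mu>_density mu.prob_space_axioms b(1,3)] by blast
  \<comment> \<open>The weight is at most linear, as \<open>q - 1 < 1\<close>, so the assumed moment of the target dominates it.\<close>
  have wm: "(1 + t) powr ?a \<le> 2 + t powr max 1 q" if t: "0 \<le> t" for t :: real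
  proof -
    have "(1 + t) powr ?a \<le> (1 + t) powr 1" using q t by (intro powr_mono) auto
    also have "\<dots> = 1 + t" using t by simp
    also have "\<dots> \<le> 2 + t powr max 1 q"
    proof (cases "t \<le> 1")
      case False
      then have "t powr 1 \<le> t powr max 1 q" by (intro powr_mono) auto
      then show ?thesis using False by simp
    qed (simp add: add_increasing2)
    finally show ?thesis .
  qed
  interpret T: singular_target q b C \<mu>
  proof
    show "integrable \<mu> (\<lambda>y. (1 + norm y) powr ?a)"
    proof (rule Bochner_Integration.integrable_bound[where f="\<lambda>y. 2 + norm y powr max 1 q"])
      show "AE y in \<mu>. norm ((1 + norm y) powr ?a) \<le> norm (2 + norm y powr max 1 q)"
        using wm by (intro AE_I2) (auto intro!: order_trans[OF _ abs_ge_self])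
    qed (use mom in auto)
  qed (use q b C mu in auto)
  \<comment> \<open>For \<open>q > 1\<close> and a bounded moment of order \<open>r > q - 1\<close>, the choice \<open>s = r / (q - 1)\<close> makes
    \<open>(q - 1) * s = r\<close>. For \<open>q \<le> 1\<close> any \<open>s > 1\<close> serves.\<close>
  obtain s S where s: "1 < s"
    and S: "\<And>N. 2 \<le> N \<Longrightarrow> (\<integral>x. (1 + norm x) powr (?a * s) \<partial>empirical N (X N)) \<le> S"
  proof (cases "q \<le> 1")
    case True
    have "(\<integral>x. (1 + norm x) powr (?a * 2) \<partial>empirical N (X N)) \<le> 1" if N: "2 \<le> N" for N
    proof -
      interpret E: prob_space "empirical N (X N)"
        by (intro prob_measuresD(1) empirical_prob_measures) (use N in simp)
      have "(1 + norm x) powr (?a * 2) = 1" for x :: 'a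
      proof -
        have "1 + norm x \<noteq> 0" using norm_ge_zero[of x] by linarith
        then show ?thesis using True by simp
      qed
      then show ?thesis using E.prob_space by simp
    qed
    then show ?thesis using that[of 2 1] by simp
  next
    case False
    then obtain r T where r: "q - 1 < r"
      and T: "\<And>N. 2 \<le> N \<Longrightarrow> (\<integral>x. norm x powr r \<partial>empirical N (X N)) \<le> T"
      using moment q by (force simp: bdd_above_def)
    have rs: "?a * (r / (q - 1)) = r" "1 < r / (q - 1)" using False r by (auto simp: max_def)
    have r0: "0 < r" using r False by simp
    have pw: "(1 + t) powr r \<le> 2 powr r * (1 + t powr r)" if t: "0 \<le> t" for t :: real
    proof (cases "t \<le> 1")
      case True
      then have "(1 + t) powr r \<le> 2 powr r" using r0 t by (intro powr_mono2) auto
      also have "\<dots> \<le> 2 powr r * (1 + t powr r)" by simp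
      finally show ?thesis .
    next
      case False
      then have "(1 + t) powr r \<le> (2 * t) powr r" using r0 t by (intro powr_mono2) auto
      also have "\<dots> = 2 powr r * t powr r" using t by (simp add: powr_mult)
      also have "\<dots> \<le> 2 powr r * (1 + t powr r)" by simp
      finally show ?thesis .
    qed
    have "(\<integral>x. (1 + norm x) powr r \<partial>empirical N (X N)) \<le> 2 powr r * (1 + T)" if N: "2 \<le> N" for N
    proof -
      interpret E: prob_space "empirical N (X N)"
        by (intro prob_measuresD(1) empirical_prob_measures) (use N in simp)
      have i: "integrable (empirical N (X N)) (\<lambda>x. norm x powr r)" "integrable (empirical N (X N)) (\<lambda>x. (1 + norm x) powr r)"
        by (auto intro!: integrable_empirical)
      have "(\<integral>x. (1 + norm x) powr r \<partial>empirical N (X N)) \<le> (\<integral>x. 2 powr r * (1 + norm x powr r) \<partial>empirical N (X N))"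
        using i pw by (intro integral_mono) auto
      also have "\<dots> = 2 powr r * (1 + (\<integral>x. norm x powr r \<partial>empirical N (X N)))"
        using i E.prob_space by simp
      also have "\<dots> \<le> 2 powr r * (1 + T)" using T[OF N] by (intro mult_left_mono) auto
      finally show ?thesis .
    qed
    then show ?thesis using that[of "r / (q - 1)" "2 powr r * (1 + T)"] rs by simp
  qed
  interpret L: vanishing_residual_limit q b C \<mu> X \<rho> s S
    by unfold_locales (fact \<rho>_prob, fact narrow, fact s, erule S, fact residual)
  show ?thesis
  proof (rule L.limit_is_critical, rule L.pair_force_integrable)
    show "inj_on (X N) {1..N}" if "2 \<le> N" for N using that by (rule distinct)
  qed (use energy q in simp)
qed


end
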